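(* Suppose that $\alpha>d$ and $\gamma:=\alpha(\tau-1)/d>1$. Then, for $\mathrm P$-almost every $\eta$, the following holds: for each $x\in\eta$ there exists a slowly varying (at $+\infty$) function $\ell(\cdot)=\ell(\cdot,\eta,x)$ such that, for $s>0$, $$P^\eta(D_x>s)=s^{-\gamma}\,\ell(s).$$
   Context: Model (scale-free percolation in continuum space). Fix $d\ge 1$, $\nu>0$, $\alpha>0$, $\tau>1$. The vertex set is a homogeneous Poisson point process $\eta$ in $\mathbb R^d$ of intensity $\nu$, with law $\mathrm P$. Given $\eta$, each $x\in\eta$ receives a random weight $W_x>0$; the weights are i.i.d. with law $P$ and distribution function $F$ satisfying $1-F(w)=P(W>w)=w^{-(\tau-1)}L(w)$, where $L$ is slowly varying at $+\infty$. Given $\eta$ and the weights $(w_x)_{x\in\eta}$, each unordered pair of distinct $x,y\in\eta$ is joined by an undirected edge (written $x\leftrightarrow y$), independently over pairs, with probability $1-\exp\{-w_xw_y/\|x-y\|^{\alpha}\}$, where $\|\cdot\|$ is the Euclidean norm. $P^\eta$ denotes the quenched law of the random graph (weights and edges) given $\eta$. The degree of $x\in\eta$ is $D_x:=\#\{y\in\eta: y\leftrightarrow x\}$. *)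

theory Defs
  imports "HOL-Probability.Probability"
begin

text \<open>Only the behaviour near infinity matters; values and regularity of the function
  elsewhere are unconstrained.\<close>

definition slowly_varying :: "(real \<Rightarrow> real) \<Rightarrow> bool" where
  "slowly_varying L \<longleftrightarrow>
     (\<exists>X. (\<forall>t\<ge>X. 0 < L t) \<and> L \<in> borel_measurable (restrict_space borel {X..})) \<and>
     (\<forall>c>0. ((\<lambda>t. L (c * t) / L t) \<longlongrightarrow> 1) at_top)"

definition locally_finite_set :: "'a::metric_space set \<Rightarrow> bool" where
  "locally_finite_set S \<longleftrightarrow> (\<forall>B. bounded B \<longrightarrow> finite (S \<inter> B))"

text \<open>A homogeneous Poisson process is almost surely simple, so it is modelled as a random
  locally finite set.  The Poisson probabilities are written out because the library's
  \<open>poisson_pmf\<close> excludes rate zero, which occurs for Lebesgue null sets.\<close>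

definition poisson_point_process ::
  "'w measure \<Rightarrow> real \<Rightarrow> ('w \<Rightarrow> 'a::euclidean_space set) \<Rightarrow> bool" where
  "poisson_point_process M \<nu> \<eta> \<longleftrightarrow>
     prob_space M \<and>
     (\<forall>\<omega>\<in>space M. locally_finite_set (\<eta> \<omega>)) \<and>
     (\<forall>A\<in>sets borel. bounded A \<longrightarrow>
        (\<lambda>\<omega>. card (\<eta> \<omega> \<inter> A)) \<in> measurable M (count_space UNIV) \<and>
        (\<forall>k. measure M {\<omega> \<in> space M. card (\<eta> \<omega> \<inter> A) = k} =
               (\<nu> * measure lborel A) ^ k / fact k * exp (- (\<nu> * measure lborel A)))) \<and>
     (\<forall>n. \<forall>A :: nat \<Rightarrow> 'a set.
        (\<forall>i<n. A i \<in> sets borel \<and> bounded (A i)) \<longrightarrow> disjoint_family_on A {..<n} \<longrightarrow>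
        prob_space.indep_vars M (\<lambda>_. count_space UNIV) (\<lambda>i \<omega>. card (\<eta> \<omega> \<inter> A i)) {..<n})"

definition vertex_pairs :: "'a set \<Rightarrow> 'a set set" where
  "vertex_pairs V = {{x, y} | x y. x \<in> V \<and> y \<in> V \<and> x \<noteq> y}"

definition edge_prob :: "real \<Rightarrow> ('a::real_normed_vector \<Rightarrow> real) \<Rightarrow> 'a set \<Rightarrow> real" where
  "edge_prob \<alpha> w e =
     (THE p. \<exists>x y. e = {x, y} \<and> x \<noteq> y \<and> p = 1 - exp (- (w x * w y / norm (x - y) powr \<alpha>)))"

lemma edge_prob_pair:
  assumes "x \<noteq> y"
  shows "edge_prob \<alpha> w {x, y} = 1 - exp (- (w x * w y / norm (x - y) powr \<alpha>))"
  unfolding edge_prob_def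
proof (rule the_equality)
  fix p
  assume "\<exists>x' y'. {x, y} = {x', y'} \<and> x' \<noteq> y' \<and>
      p = 1 - exp (- (w x' * w y' / norm (x' - y') powr \<alpha>))"
  then show "p = 1 - exp (- (w x * w y / norm (x - y) powr \<alpha>))"
    by (auto simp: doubleton_eq_iff norm_minus_commute mult.commute)
qed (use assms in blast)

text \<open>An outcome is a pair of a weight function on the vertex set \<open>V\<close> and an edge indicator on
  the unordered pairs of distinct vertices.  \<open>W\<close> is the law of a single weight.\<close>

definition graph_space ::
  "'a set \<Rightarrow> real measure \<Rightarrow> (('a \<Rightarrow> real) \<times> ('a set \<Rightarrow> bool)) measure" where
  "graph_space V W =
     (\<Pi>\<^sub>M x\<in>V. W) \<Otimes>\<^sub>M (\<Pi>\<^sub>M e\<in>vertex_pairs V. count_space UNIV)"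

definition quenched_law ::
  "real measure \<Rightarrow> real \<Rightarrow> 'a::real_normed_vector set \<Rightarrow>
     (('a \<Rightarrow> real) \<times> ('a set \<Rightarrow> bool)) measure" where
  "quenched_law W \<alpha> V =
     (\<Pi>\<^sub>M x\<in>V. W) \<bind>
       (\<lambda>w. distr (\<Pi>\<^sub>M e\<in>vertex_pairs V. measure_pmf (bernoulli_pmf (edge_prob \<alpha> w e)))
                (graph_space V W) (Pair w))"

text \<open>The degree is extended-valued, since \<open>card\<close> would assign 0 to a vertex with infinitely
  many neighbours.\<close>

definition vertex_degree :: "'a set \<Rightarrow> 'a \<Rightarrow> ('a \<Rightarrow> real) \<times> ('a set \<Rightarrow> bool) \<Rightarrow> ennreal" where
  "vertex_degree V x g = emeasure (count_space UNIV) {y \<in> V. y \<noteq> x \<and> snd g {x, y}}"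

end

theory Submission
  imports Defs "HOL-Real_Asymp.Real_Asymp"
begin

text \<open>
  Given its own weight \<open>W\<^sub>x = u\<close>, the degree of \<open>x\<close> is a sum of independent Bernoulli variables, since
  each other weight enters a single edge at \<open>x\<close>.  For almost every \<open>\<eta>\<close> the number of vertices in a
  ball grows like the volume, which makes the conditional mean \<open>m u\<close> asymptotic to a constant times
  \<open>u powr (d / \<alpha>)\<close>; here \<open>\<alpha> > d\<close> and \<open>\<gamma> > 1\<close> (a finite moment of order \<open>d / \<alpha>\<close> of the weights) enter.
  By Chernoff's bound the degree concentrates around \<open>m u\<close> with exponentially small errors, which are
  negligible against a regularly varying tail.  Hence \<open>P(D\<^sub>x > s)\<close> is equivalent to the
  probability that \<open>m W\<^sub>x > s\<close>, which is regularly varying of index \<open>- (\<tau> - 1) / (d / \<alpha>) = - \<gamma>\<close>.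
\<close>

section \<open>Regular variation\<close>

text \<open>With the point set frozen, sums over vertices cannot be replaced by Lebesgue integrals;
  what is used of the Poisson process is the growth of its counts. Writing an averaged edge
  probability as the chance that a random ball around \<open>x\<close> reaches \<open>y\<close>
  turns the conditional mean into an integral of the counting function, to which dominated
  convergence applies. The exceptional null set comes from balls at the origin alone and so serves
  every \<open>x\<close> at once.

  The other obstacle is that \<open>x\<close> may have infinitely many potential neighbours. Exact
  computations are made for finite sets \<open>F\<close> of them, and the resulting error terms see
  \<open>F\<close> only through a sum of averaged edge probabilities, which converges along an
  exhaustion. A tilt \<open>c > 1\<close> gives the upper bound and \<open>c < 1\<close> the lower
  one; with \<open>c\<close> fixed while \<open>s\<close> grows, the loss is a constant factor that
  tends to 1 as \<open>c\<close> tends to 1.\<close>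

definition regularly_varying :: "real \<Rightarrow> (real \<Rightarrow> real) \<Rightarrow> bool" where
  "regularly_varying \<rho> f \<longleftrightarrow> (\<forall>\<^sub>F t in at_top. 0 < f t) \<and>
     (\<forall>c>0. ((\<lambda>t. f (c * t) / f t) \<longlongrightarrow> c powr \<rho>) at_top)"

lemma ln_less_self_minus_one:
  fixes x :: real
  assumes "0 < x" "x \<noteq> 1"
  shows "ln x < x - 1"
  using ln_le_minus_one[of x] ln_eq_minus_one[of x] assms by fastforce

text \<open>Halving moves any \<open>t\<close> into the first block \<open>[t0, 2 * t0]\<close>.
  Applied to \<open>G t * t powr \<sigma>\<close> and to its negative, this yields power bounds for
  a monotone \<open>G\<close> from the ratio at the single scale 2, in place of the uniform
  convergence theorem.\<close>

lemma doubling_bound: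
  fixes h :: "real \<Rightarrow> real"
  assumes "0 < t0" and step: "\<And>t. t0 \<le> t \<Longrightarrow> h (2 * t) \<le> h t"
    and base: "\<And>t. t0 \<le> t \<Longrightarrow> t \<le> 2 * t0 \<Longrightarrow> h t \<le> B" and "t0 \<le> t"
  shows "h t \<le> B"
proof -
  have *: "h t \<le> B" if "t0 \<le> t" "t \<le> 2 ^ n * t0" for n t
    using that
  proof (induction n arbitrary: t)
    case (Suc n)
    show ?case
    proof (cases "t \<le> 2 * t0")
      case False
      have "h (t / 2) \<le> B" using False Suc.prems by (intro Suc.IH) auto
      moreover have "h t \<le> h (t / 2)" using step[of "t / 2"] False by simp
      ultimately show ?thesis by simp
    qed (use base Suc.prems in auto)
  qed (use base \<open>0 < t0\<close> in auto)
  obtain n where "t / t0 < 2 ^ n" using real_arch_pow[of 2 "t / t0"] by auto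
  then have "t \<le> 2 ^ n * t0" using \<open>0 < t0\<close> by (simp add: field_simps)
  then show ?thesis using * \<open>t0 \<le> t\<close> by blast
qed

lemma slowly_varying_imp_regularly_varying:
  assumes L: "slowly_varying L" and G: "\<And>t. 0 < t \<Longrightarrow> G t = t powr p * L t"
  shows "regularly_varying p G"
proof -
  obtain X where "\<And>t. X \<le> t \<Longrightarrow> 0 < L t" using L by (auto simp: slowly_varying_def)
  then have "0 < G t" if "max 1 X \<le> t" for t using that G by auto
  then have "\<forall>\<^sub>F t in at_top. 0 < G t" unfolding eventually_at_top_linorder by blast
  moreover have "((\<lambda>t. G (c * t) / G t) \<longlongrightarrow> c powr p) at_top" if "0 < c" for c
  proof -
    have "((\<lambda>t. c powr p * (L (c * t) / L t)) \<longlongrightarrow> c powr p * 1) at_top"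
      using L that by (intro tendsto_intros) (auto simp: slowly_varying_def)
    moreover have "\<forall>\<^sub>F t in at_top. c powr p * (L (c * t) / L t) = G (c * t) / G t"
      using eventually_gt_at_top[of 0] by eventually_elim (use that in \<open>simp add: G powr_mult\<close>)
    ultimately have "((\<lambda>t. G (c * t) / G t) \<longlongrightarrow> c powr p * 1) at_top"
      by (rule Lim_transform_eventually)
    then show ?thesis by simp
  qed
  ultimately show ?thesis by (simp add: regularly_varying_def)
qed

lemma regularly_varying_imp_slowly_varying:
  assumes T: "regularly_varying (- p) T" and anti: "\<And>s t. 0 \<le> s \<Longrightarrow> s \<le> t \<Longrightarrow> T t \<le> T s"
  shows "slowly_varying (\<lambda>s. s powr p * T s)"
proof -
  have "\<forall>\<^sub>F t in at_top. 0 < T t" using T by (simp add: regularly_varying_def)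
  then obtain X where X: "\<And>t. X \<le> t \<Longrightarrow> 0 < T t" by (auto simp: eventually_at_top_linorder)
  \<comment> \<open>\<open>T\<close> is antitone only on the nonnegative axis. Composing with
    \<open>max 0\<close> makes it monotone everywhere, hence Borel, and changes nothing on the
    half-line where measurability is required.\<close>
  have "(\<lambda>s. - T (max 0 s)) \<in> borel_measurable borel"
    by (rule borel_measurable_mono) (auto intro!: monoI anti)
  then have "(\<lambda>s. s powr p * - (- T (max 0 s))) \<in> borel_measurable borel" by measurable
  then have "(\<lambda>s. s powr p * T (max 0 s)) \<in> borel_measurable (restrict_space borel {max 1 X..})"
    by (simp add: measurable_restrict_space1)
  also have "?this \<longleftrightarrow> (\<lambda>s. s powr p * T s) \<in> borel_measurable (restrict_space borel {max 1 X..})"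
    by (intro measurable_cong) (auto simp: space_restrict_space max_def split: if_splits)
  finally have meas: "(\<lambda>s. s powr p * T s) \<in> borel_measurable (restrict_space borel {max 1 X..})" .
  have "((\<lambda>t. (c * t) powr p * T (c * t) / (t powr p * T t)) \<longlongrightarrow> 1) at_top" if "0 < c" for c
  proof -
    have "((\<lambda>t. c powr p * (T (c * t) / T t)) \<longlongrightarrow> c powr p * c powr (- p)) at_top"
      using T that by (intro tendsto_intros) (auto simp: regularly_varying_def)
    moreover have "\<forall>\<^sub>F t in at_top. c powr p * (T (c * t) / T t) = (c * t) powr p * T (c * t) / (t powr p * T t)"
      using eventually_gt_at_top[of 0] by eventually_elim (use that in \<open>simp add: powr_mult\<close>)
    ultimately have "((\<lambda>t. (c * t) powr p * T (c * t) / (t powr p * T t)) \<longlongrightarrow> c powr p * c powr (- p)) at_top"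
      by (rule Lim_transform_eventually)
    then show ?thesis using that by (simp add: powr_minus)
  qed
  moreover have "\<forall>t\<ge>max 1 X. 0 < t powr p * T t" using X by auto
  ultimately show ?thesis using meas unfolding slowly_varying_def by blast
qed

section \<open>Power bounds and moments of regularly varying tails\<close>

lemma regularly_varying_threshold:
  assumes "regularly_varying \<rho> G" and "open U" and "2 powr \<rho> \<in> U"
  obtains t0 where "t0 \<ge> 1" and "\<And>t. t0 \<le> t \<Longrightarrow> 0 < G t" and "\<And>t. t0 \<le> t \<Longrightarrow> G (2 * t) / G t \<in> U"
proof -
  have lim: "((\<lambda>t. G (2 * t) / G t) \<longlongrightarrow> 2 powr \<rho>) at_top"
    and "\<forall>\<^sub>F t in at_top. 0 < G t"
    using assms(1) by (auto simp: regularly_varying_def)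
  then have "\<forall>\<^sub>F t in at_top. 0 < G t \<and> G (2 * t) / G t \<in> U"
    using topological_tendstoD[OF lim assms(2,3)] by (rule_tac eventually_conj)
  then obtain t1 where "\<And>t. t1 \<le> t \<Longrightarrow> 0 < G t \<and> G (2 * t) / G t \<in> U"
    by (auto simp: eventually_at_top_linorder)
  then show ?thesis by (intro that[of "max 1 t1"]) auto
qed

text \<open>One half of Potter's bounds. Since \<sigma> < \<rho>, the ratio at scale 2 is eventually
  below \<open>2 powr (- \<sigma>)\<close>, so \<open>G t * t powr \<sigma>\<close> does not
  increase under doubling; on the first block it is bounded because \<open>G\<close> is antitone and
  the power is increasing.\<close>

lemma regularly_varying_upper:
  assumes "regularly_varying (- \<rho>) G" and "antimono G" and "0 < \<sigma>" "\<sigma> < \<rho>"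
  obtains K t0 where "t0 \<ge> 1" and "\<And>t. t0 \<le> t \<Longrightarrow> G t \<le> K * t powr (- \<sigma>)"
proof -
  obtain t0 where t0: "t0 \<ge> 1" "\<And>t. t0 \<le> t \<Longrightarrow> 0 < G t"
      "\<And>t. t0 \<le> t \<Longrightarrow> G (2 * t) / G t \<in> {..< 2 powr (- \<sigma>)}"
    by (rule regularly_varying_threshold[OF assms(1), of "{..< 2 powr (- \<sigma>)}"]) (use assms(4) in auto)
  define h where "h t = G t * t powr \<sigma>" for t
  have "h t \<le> G t0 * (2 * t0) powr \<sigma>" if "t0 \<le> t" for t
  proof (rule doubling_bound[of t0 h])
    fix t assume t: "t0 \<le> t"
    have "G (2 * t) \<le> 2 powr (- \<sigma>) * G t"
      using t0(2,3)[OF t] by (simp add: field_simps)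
    then have "G (2 * t) * (2 * t) powr \<sigma> \<le> 2 powr (- \<sigma>) * G t * (2 * t) powr \<sigma>"
      by (intro mult_right_mono) auto
    also have "\<dots> = h t"
      using t t0(1) by (simp add: h_def powr_mult powr_minus field_simps)
    finally show "h (2 * t) \<le> h t" by (simp add: h_def)
  next
    fix t assume t: "t0 \<le> t" "t \<le> 2 * t0"
    then show "h t \<le> G t0 * (2 * t0) powr \<sigma>"
      unfolding h_def using t0(1) assms(3) antimonoD[OF assms(2) t(1)] t0(2)[of t0]
      by (intro mult_mono powr_mono2) auto
  qed (use that t0(1) in auto)
  then show ?thesis
    using t0(1) by (intro that[of t0 "G t0 * (2 * t0) powr \<sigma>"]) (auto simp: h_def powr_minus field_simps)
qed

text \<open>The other half of Potter's bounds, with the sign of \<open>h\<close> reversed. It serves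
  to show that exponentially small errors are negligible against the tail.\<close>

lemma regularly_varying_lower:
  assumes "regularly_varying (- \<rho>) G" and "antimono G" and "0 < \<sigma>" "\<rho> < \<sigma>"
  obtains k t0 where "k > 0" "t0 \<ge> 1" and "\<And>t. t0 \<le> t \<Longrightarrow> k * t powr (- \<sigma>) \<le> G t"
proof -
  obtain t0 where t0: "t0 \<ge> 1" "\<And>t. t0 \<le> t \<Longrightarrow> 0 < G t"
      "\<And>t. t0 \<le> t \<Longrightarrow> G (2 * t) / G t \<in> {2 powr (- \<sigma>) <..}"
    by (rule regularly_varying_threshold[OF assms(1), of "{2 powr (- \<sigma>) <..}"]) (use assms(4) in auto)
  define h where "h t = - (G t * t powr \<sigma>)" for t
  have "h t \<le> - (G (2 * t0) * t0 powr \<sigma>)" if "t0 \<le> t" for t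
  proof (rule doubling_bound[of t0 h])
    fix t assume t: "t0 \<le> t"
    have "2 powr (- \<sigma>) * G t \<le> G (2 * t)"
      using t0(2,3)[OF t] by (simp add: field_simps)
    then have "2 powr (- \<sigma>) * G t * (2 * t) powr \<sigma> \<le> G (2 * t) * (2 * t) powr \<sigma>"
      by (intro mult_right_mono) auto
    moreover have "2 powr (- \<sigma>) * G t * (2 * t) powr \<sigma> = - h t"
      using t t0(1) by (simp add: h_def powr_mult powr_minus field_simps)
    ultimately show "h (2 * t) \<le> h t" by (simp add: h_def)
  next
    fix t assume t: "t0 \<le> t" "t \<le> 2 * t0"
    then show "h t \<le> - (G (2 * t0) * t0 powr \<sigma>)"
      unfolding h_def neg_le_iff_le
      using t0(1) assms(3) antimonoD[OF assms(2) t(2)] t0(2)[of t]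
      by (intro mult_mono powr_mono2) auto
  qed (use that t0(1) in auto)
  then show ?thesis
    using t0(1) t0(2)[of "2 * t0"]
    by (intro that[of "G (2 * t0) * t0 powr \<sigma>" t0]) (auto simp: h_def powr_minus field_simps)
qed

text \<open>Dyadic layers: for \<open>w\<close> between \<open>b n\<close> and
  \<open>b (Suc n)\<close> the integrand is at most \<open>b (Suc n) powr \<beta>\<close>, and the
  layer has mass at most \<open>K * b n powr (- \<sigma>)\<close>. The products form a geometric
  series of ratio \<open>2 powr (\<beta> - \<sigma>) < 1\<close>.\<close>

lemma moment_finite:
  fixes W :: "real measure"
  assumes "prob_space W" and [measurable_cong]: "sets W = sets borel" and "0 < \<beta>" "\<beta> < \<sigma>" "1 \<le> t0"
    and tail: "\<And>t. t0 \<le> t \<Longrightarrow> measure W {t<..} \<le> K * t powr (- \<sigma>)"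
  shows "(\<integral>\<^sup>+w. ennreal (w powr \<beta>) * indicator {0<..} w \<partial>W) < \<infinity>"
proof -
  interpret prob_space W by fact
  define b where "b n = 2 ^ n * t0" for n :: nat
  have b: "t0 \<le> b n" "0 < b n" for n
    using \<open>1 \<le> t0\<close> one_le_power[of "2::real" n] by (auto simp: b_def)
  have "0 \<le> K * t0 powr (- \<sigma>)" using tail[of t0] measure_nonneg[of W "{t0<..}"] by linarith
  then have "0 \<le> K" using \<open>1 \<le> t0\<close> by (simp add: zero_le_mult_iff)
  have le: "ennreal (w powr \<beta>) * indicator {0<..} w \<le>
      ennreal (t0 powr \<beta>) + (\<Sum>n. ennreal (b (Suc n) powr \<beta>) * indicator {b n<..} w)" for w
  proof (cases "w \<le> t0")
    case True
    then have "ennreal (w powr \<beta>) * indicator {0<..} w \<le> ennreal (t0 powr \<beta>)"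
      using \<open>0 < \<beta>\<close> by (auto simp: indicator_def intro!: ennreal_leI powr_mono2)
    then show ?thesis by (simp add: add_increasing2)
  next
    case False
    obtain k where "w / t0 < 2 ^ k" using real_arch_pow[of 2 "w / t0"] by auto
    then have ex: "w \<le> b k" using \<open>1 \<le> t0\<close> by (simp add: field_simps b_def)
    define N where "N = (LEAST k. w \<le> b k)"
    have N: "w \<le> b N" unfolding N_def using ex by (rule LeastI)
    then have "N \<noteq> 0" using False by (cases N) (auto simp: b_def)
    then obtain n where n: "N = Suc n" by (cases N) auto
    then have "b n < w" using not_less_Least[of n "\<lambda>k. w \<le> b k"] by (auto simp: N_def)
    then have "ennreal (w powr \<beta>) * indicator {0<..} w \<le>
        ennreal (b (Suc n) powr \<beta>) * indicator {b n<..} w"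
      using N n b(2)[of n] \<open>0 < \<beta>\<close> by (auto simp: indicator_def intro!: ennreal_leI powr_mono2)
    also have "\<dots> \<le> (\<Sum>n. ennreal (b (Suc n) powr \<beta>) * indicator {b n<..} w)"
      by (rule order_trans[OF _ sum_le_suminf[of _ "{n}"]]) (auto simp del: sum_mult_indicator)
    finally show ?thesis by (simp add: add_increasing)
  qed
  define C where "C = K * 2 powr \<beta> * t0 powr (\<beta> - \<sigma>)"
  have summand: "b (Suc n) powr \<beta> * (K * b n powr (- \<sigma>)) = C * (2 powr (\<beta> - \<sigma>)) ^ n" for n
  proof -
    have "b (Suc n) powr \<beta> * (K * b n powr (- \<sigma>)) = K * 2 powr \<beta> * (b n powr \<beta> * b n powr (- \<sigma>))"
      by (simp add: b_def powr_mult field_simps)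
    also have "b n powr \<beta> * b n powr (- \<sigma>) = b n powr (\<beta> - \<sigma>)"
      by (simp add: powr_add[symmetric])
    also have "\<dots> = (2 powr (\<beta> - \<sigma>)) ^ n * t0 powr (\<beta> - \<sigma>)"
      using \<open>1 \<le> t0\<close> by (simp add: b_def powr_mult powr_powr powr_realpow[symmetric] mult.commute)
    finally show ?thesis by (simp only: C_def ac_simps)
  qed
  have "(\<integral>\<^sup>+w. ennreal (w powr \<beta>) * indicator {0<..} w \<partial>W) \<le>
      (\<integral>\<^sup>+w. ennreal (t0 powr \<beta>) + (\<Sum>n. ennreal (b (Suc n) powr \<beta>) * indicator {b n<..} w) \<partial>W)"
    by (intro nn_integral_mono le)
  also have "\<dots> = ennreal (t0 powr \<beta>) + (\<Sum>n. ennreal (b (Suc n) powr \<beta>) * emeasure W {b n<..})"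
    by (simp add: nn_integral_add nn_integral_suminf nn_integral_cmult emeasure_space_1)
  also have "(\<Sum>n. ennreal (b (Suc n) powr \<beta>) * emeasure W {b n<..}) \<le>
      (\<Sum>n. ennreal (C * (2 powr (\<beta> - \<sigma>)) ^ n))"
  proof (intro suminf_le)
    fix n
    have "ennreal (b (Suc n) powr \<beta>) * emeasure W {b n<..} \<le> ennreal (b (Suc n) powr \<beta> * (K * b n powr (- \<sigma>)))"
      unfolding emeasure_eq_measure ennreal_mult'[OF powr_ge_zero, symmetric]
      by (intro ennreal_leI mult_left_mono tail b) auto
    then show "ennreal (b (Suc n) powr \<beta>) * emeasure W {b n<..} \<le> ennreal (C * (2 powr (\<beta> - \<sigma>)) ^ n)"
      by (simp add: summand)
  qed auto
  also have "\<dots> < \<infinity>"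
  proof -
    have "0 \<le> C" using \<open>0 \<le> K\<close> by (simp add: C_def)
    moreover have "summable (\<lambda>n. C * (2 powr (\<beta> - \<sigma>)) ^ n)"
      using assms(4) powr_less_mono[of "\<beta> - \<sigma>" 0 2] by (intro summable_mult summable_geometric) auto
    ultimately show ?thesis by (subst suminf_ennreal2) auto
  qed
  finally show ?thesis by (simp add: add_mono)
qed


text \<open>Chernoff's bound at the tilt \<open>c\<close> is effective for the weight threshold \<open>a c s\<close> below, at which
  the conditional mean \<open>m\<close> is about \<open>s / c\<^sup>2\<close>: the exponent there is at most \<open>- k c * s\<close>.\<close>

lemma tail_asymptotics:
  fixes G m T :: "real \<Rightarrow> real"
  assumes G: "regularly_varying (- \<rho>) G" "antimono G" and "0 < \<rho>" "0 < \<beta>" "0 < C"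
    and m: "((\<lambda>a. m a / a powr \<beta>) \<longlongrightarrow> C) at_top"
    and upper: "\<And>c a s. 1 < c \<Longrightarrow> 0 < a \<Longrightarrow> 0 < s \<Longrightarrow> T s \<le> G a + c powr (- s) * exp ((c - 1) * m a)"
    and lower: "\<And>c a s. 0 < c \<Longrightarrow> c < 1 \<Longrightarrow> 0 < a \<Longrightarrow> 0 < s \<Longrightarrow>
      G a * (1 - c powr (- s) * exp ((c - 1) * m a)) \<le> T s"
  shows "regularly_varying (- (\<rho> / \<beta>)) T"
proof -
  define a where "a c s = (s / (c\<^sup>2 * C)) powr (1 / \<beta>)" for c s :: real
  \<comment> \<open>If \<open>G\<close> is the tail of a weight \<open>X\<close>, this is the tail
    of \<open>C * X powr \<beta>\<close>, that is, of the leading term of the conditional mean. The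
    goal is \<open>T s / H s\<close> tending to 1; regular variation then passes from
    \<open>H\<close> to \<open>T\<close>.\<close>
  define H where "H s = G (a 1 s)" for s
  have Gpos: "\<forall>\<^sub>F t in at_top. 0 < G t"
    and Glim: "\<And>c. 0 < c \<Longrightarrow> ((\<lambda>t. G (c * t) / G t) \<longlongrightarrow> c powr (- \<rho>)) at_top"
    using G(1) by (auto simp: regularly_varying_def)
  have a_top: "filterlim (a c) at_top at_top" if "0 < c" for c
  proof -
    have "filterlim (\<lambda>s. (s / D) powr p) at_top at_top" if "0 < D" "0 < p" for D p :: real
      using that by real_asymp
    then show ?thesis using that \<open>0 < C\<close> \<open>0 < \<beta>\<close> by (simp add: a_def[abs_def])
  qed
  have a_scale: "a 1 (c * s) = c powr (1 / \<beta>) * a 1 s" if "0 < c" "0 < s" for c s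
    using that \<open>0 < C\<close> by (simp add: a_def powr_mult powr_divide)
  have a_c: "a c s = a 1 (inverse (c\<^sup>2) * s)" for c s
    by (simp add: a_def field_simps)
  have Hpos: "\<forall>\<^sub>F s in at_top. 0 < H s"
    unfolding H_def using eventually_compose_filterlim[OF Gpos a_top[of 1]] by simp
  have Hlim: "((\<lambda>s. H (c * s) / H s) \<longlongrightarrow> c powr (- (\<rho> / \<beta>))) at_top" if "0 < c" for c
  proof -
    have "((\<lambda>s. G (c powr (1 / \<beta>) * a 1 s) / G (a 1 s)) \<longlongrightarrow> (c powr (1 / \<beta>)) powr (- \<rho>)) at_top"
      using that by (intro filterlim_compose[OF Glim a_top]) auto
    moreover have "\<forall>\<^sub>F s in at_top. G (c powr (1 / \<beta>) * a 1 s) / G (a 1 s) = H (c * s) / H s"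
      using eventually_gt_at_top[of 0] by eventually_elim (simp add: H_def a_scale that)
    ultimately show ?thesis
      by (simp add: powr_powr tendsto_cong)
  qed
  \<comment> \<open>\<open>k c * s\<close> is the Poisson large deviation rate for reaching the
    level \<open>s\<close> from the mean \<open>s / c\<close>, the mean for which the tilt
    \<open>c\<close> is optimal.\<close>
  define k where "k c = ln c - 1 + 1 / c" for c :: real
  have k_pos: "0 < k c" if "0 < c" "c \<noteq> 1" for c
    using ln_less_self_minus_one[of "1 / c"] that by (simp add: k_def ln_div)
  have m_a: "((\<lambda>s. m (a c s) / s) \<longlongrightarrow> 1 / c\<^sup>2) at_top" if "0 < c" for c
  proof -
    have "((\<lambda>s. m (a c s) / a c s powr \<beta> * (1 / (c\<^sup>2 * C))) \<longlongrightarrow> C * (1 / (c\<^sup>2 * C))) at_top"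
      by (intro tendsto_intros filterlim_compose[OF m a_top] that)
    moreover have "\<forall>\<^sub>F s in at_top. m (a c s) / a c s powr \<beta> * (1 / (c\<^sup>2 * C)) = m (a c s) / s"
      using eventually_gt_at_top[of 0] by eventually_elim
        (use that \<open>0 < C\<close> \<open>0 < \<beta>\<close> in \<open>simp add: a_def powr_powr\<close>)
    ultimately have "((\<lambda>s. m (a c s) / s) \<longlongrightarrow> C * (1 / (c\<^sup>2 * C))) at_top"
      by (rule Lim_transform_eventually)
    then show ?thesis
      using \<open>0 < C\<close> that by simp
  qed
  have chernoff: "\<forall>\<^sub>F s in at_top. c powr (- s) * exp ((c - 1) * m (a c s)) \<le> exp (- (k c * s))"
    if "0 < c" "c \<noteq> 1" for c
  proof -
    \<comment> \<open>Only the limit of \<open>m (a c s) / s\<close> is known, so some room is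
      needed. Aiming at the mean \<open>s / c\<^sup>2\<close> instead of the critical
      \<open>s / c\<close> leaves the strict gap \<open>(c - 1)\<^sup>2 / c\<^sup>2\<close>, with
      the right sign on both sides of \<open>c = 1\<close>.\<close>
    have "\<forall>\<^sub>F s in at_top. (c - 1) * (m (a c s) / s) < (c - 1) * (1 / c)"
    proof (rule order_tendstoD(2))
      show "((\<lambda>s. (c - 1) * (m (a c s) / s)) \<longlongrightarrow> (c - 1) * (1 / c\<^sup>2)) at_top"
        by (intro tendsto_intros m_a that)
      have "0 < (c - 1)\<^sup>2 / c\<^sup>2" using that by simp
      also have "(c - 1)\<^sup>2 / c\<^sup>2 = (c - 1) * (1 / c) - (c - 1) * (1 / c\<^sup>2)"
        using that by (simp add: field_simps power2_eq_square)
      finally show "(c - 1) * (1 / c\<^sup>2) < (c - 1) * (1 / c)" by simp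
    qed
    then show ?thesis using eventually_gt_at_top[of 0]
    proof eventually_elim
      case (elim s)
      then have "(c - 1) * m (a c s) \<le> (c - 1) * (1 / c) * s"
        by (simp add: field_simps)
      moreover have "- s * ln c + (c - 1) * (1 / c) * s = - (k c * s)"
        using that by (simp add: k_def field_simps)
      ultimately have "exp (- s * ln c + (c - 1) * m (a c s)) \<le> exp (- (k c * s))"
        by (subst exp_le_cancel_iff) linarith
      moreover have "c powr (- s) = exp (- s * ln c)"
        using that by (simp add: powr_def)
      ultimately show ?case by (simp only: exp_add)
    qed
  qed
  have exp_H: "((\<lambda>s. exp (- (\<kappa> * s)) / H s) \<longlongrightarrow> 0) at_top" if "0 < \<kappa>" for \<kappa>
  proof -
    obtain k0 t0 where k0: "k0 > 0" "t0 \<ge> 1" "\<And>t. t0 \<le> t \<Longrightarrow> k0 * t powr (- (\<rho> + 1)) \<le> G t"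
      \<comment> \<open>Any exponent above \<rho> would serve: a power minorant of \<open>H\<close>
        already dominates every decaying exponential.\<close>
      by (rule regularly_varying_lower[OF G, of "\<rho> + 1"]) (use \<open>0 < \<rho>\<close> in auto)
    define \<sigma> where "\<sigma> = (\<rho> + 1) / \<beta>"
    define B where "B = k0 * (1 / C) powr (- \<sigma>)"
    have "0 < B" using k0(1) \<open>0 < C\<close> by (simp add: B_def)
    have "\<forall>\<^sub>F s in at_top. t0 \<le> a 1 s"
      using a_top[of 1] by (simp add: filterlim_at_top)
    then have bnd: "\<forall>\<^sub>F s in at_top. norm (exp (- (\<kappa> * s)) / H s) \<le> (1 / B) * (s powr \<sigma> * exp (- (\<kappa> * s)))"
      using eventually_gt_at_top[of 0]
    proof eventually_elim
      case (elim s)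
      have "(1 / \<beta>) * (- (\<rho> + 1)) = - \<sigma>"
        by (simp add: \<sigma>_def diff_divide_distrib add_divide_distrib)
      then have "a 1 s powr (- (\<rho> + 1)) = (s / C) powr (- \<sigma>)"
        by (simp only: a_def powr_powr power_one mult_1)
      then have "B * s powr (- \<sigma>) = k0 * (a 1 s) powr (- (\<rho> + 1))"
        using elim \<open>0 < C\<close> by (simp add: B_def powr_mult[symmetric])
      then have *: "B * s powr (- \<sigma>) \<le> H s" using k0(3)[OF elim(1)] by (simp add: H_def)
      have "0 < B * s powr (- \<sigma>)" using \<open>0 < B\<close> elim by simp
      have "exp (- (\<kappa> * s)) / H s \<le> exp (- (\<kappa> * s)) / (B * s powr (- \<sigma>))"
        using * \<open>0 < B\<close> elim order_less_le_trans[OF \<open>0 < B * s powr (- \<sigma>)\<close> *]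
        by (intro divide_left_mono mult_pos_pos) auto
      also have "\<dots> = (1 / B) * (s powr \<sigma> * exp (- (\<kappa> * s)))"
        by (simp add: powr_minus divide_inverse ac_simps)
      finally show ?case using order_less_le_trans[OF \<open>0 < B * s powr (- \<sigma>)\<close> *] by simp
    qed
    have "0 < \<sigma>" using \<open>0 < \<rho>\<close> \<open>0 < \<beta>\<close> by (simp add: \<sigma>_def)
    with \<open>0 < \<kappa>\<close> have "((\<lambda>s. s powr \<sigma> * exp (- (\<kappa> * s))) \<longlongrightarrow> 0) at_top"
      by real_asymp
    from tendsto_mult_left[OF this, of "1 / B"]
    have "((\<lambda>s. (1 / B) * (s powr \<sigma> * exp (- (\<kappa> * s)))) \<longlongrightarrow> (1 / B) * 0) at_top" .
    then show ?thesis by (intro Lim_null_comparison[OF bnd]) simp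
  qed
  have exp_0: "((\<lambda>s. exp (- (\<kappa> * s))) \<longlongrightarrow> 0) at_top" if "0 < \<kappa>" for \<kappa> :: real
    using that by real_asymp
  have up: "\<forall>\<^sub>F s in at_top. T s / H s < b" if "1 < b" for b
  proof -
    \<comment> \<open>As \<open>s\<close> grows with \<open>c\<close> fixed, moving the threshold
      costs the factor \<open>inverse (c\<^sup>2) powr (- (\<rho> / \<beta>))\<close>. It tends to 1
      with \<open>c\<close>, so \<open>c\<close> is chosen before \<open>s\<close>.\<close>
    have "((\<lambda>c. inverse (c\<^sup>2) powr (- (\<rho> / \<beta>))) \<longlongrightarrow> inverse (1\<^sup>2) powr (- (\<rho> / \<beta>))) (at_right (1::real))"
      by (intro tendsto_intros) auto
    then have "\<forall>\<^sub>F c in at_right 1. inverse (c\<^sup>2) powr (- (\<rho> / \<beta>)) < b"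
      by (rule order_tendstoD) (use that in simp)
    then have "\<forall>\<^sub>F c in at_right 1. inverse (c\<^sup>2) powr (- (\<rho> / \<beta>)) < b \<and> 1 < c"
      using eventually_at_right_less[of 1] by eventually_elim simp
    then obtain c where c: "inverse (c\<^sup>2) powr (- (\<rho> / \<beta>)) < b" "1 < c"
      by (auto dest!: eventually_happens'[OF trivial_limit_at_right_real])
    then have c_pos: "0 < c" by simp
    have "((\<lambda>s. H (inverse (c\<^sup>2) * s) / H s + exp (- (k c * s)) / H s) \<longlongrightarrow>
        inverse (c\<^sup>2) powr (- (\<rho> / \<beta>)) + 0) at_top"
      using c by (intro tendsto_add Hlim exp_H k_pos) auto
    then have "\<forall>\<^sub>F s in at_top. H (inverse (c\<^sup>2) * s) / H s + exp (- (k c * s)) / H s < b"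
      by (rule order_tendstoD) (use c in simp)
    moreover have "\<forall>\<^sub>F s in at_top. 0 < a c s"
      using a_top[OF c_pos] by (auto simp: filterlim_at_top_dense)
    moreover have "\<forall>\<^sub>F s in at_top. c powr (- s) * exp ((c - 1) * m (a c s)) \<le> exp (- (k c * s))"
      using c by (intro chernoff) auto
    ultimately show ?thesis using Hpos eventually_gt_at_top[of 0]
    proof eventually_elim
      case (elim s)
      have "T s \<le> H (inverse (c\<^sup>2) * s) + exp (- (k c * s))"
        using upper[OF c(2) elim(2,5)] elim(3) by (simp add: H_def a_c[symmetric])
      then have "T s / H s \<le> H (inverse (c\<^sup>2) * s) / H s + exp (- (k c * s)) / H s"
        using elim(4) by (simp add: field_simps)
      then show ?case using elim(1) by linarith
    qed
  qed
  have lo: "\<forall>\<^sub>F s in at_top. b < T s / H s" if "b < 1" for b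
  proof -
    have "((\<lambda>c. inverse (c\<^sup>2) powr (- (\<rho> / \<beta>))) \<longlongrightarrow> inverse (1\<^sup>2) powr (- (\<rho> / \<beta>))) (at_left (1::real))"
      by (intro tendsto_intros) auto
    then have "\<forall>\<^sub>F c in at_left 1. b < inverse (c\<^sup>2) powr (- (\<rho> / \<beta>))"
      by (rule order_tendstoD) (use that in simp)
    then have "\<forall>\<^sub>F c in at_left 1. b < inverse (c\<^sup>2) powr (- (\<rho> / \<beta>)) \<and> c \<in> {0<..<1}"
      using eventually_at_left_real[OF zero_less_one] by eventually_elim simp
    then obtain c where c: "b < inverse (c\<^sup>2) powr (- (\<rho> / \<beta>))" "0 < c" "c < 1"
      by (auto dest!: eventually_happens'[OF trivial_limit_at_left_real])
    note c_pos = c(2)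
    \<comment> \<open>Here the error multiplies \<open>G\<close> and only has to vanish; in the
      upper bound it was additive and had to be small relative to \<open>H\<close>.\<close>
    have "((\<lambda>s. H (inverse (c\<^sup>2) * s) / H s * (1 - exp (- (k c * s)))) \<longlongrightarrow>
        inverse (c\<^sup>2) powr (- (\<rho> / \<beta>)) * (1 - 0)) at_top"
      using c by (intro tendsto_intros Hlim exp_0 k_pos) auto
    then have "\<forall>\<^sub>F s in at_top. b < H (inverse (c\<^sup>2) * s) / H s * (1 - exp (- (k c * s)))"
      by (rule order_tendstoD) (use c in simp)
    moreover have "\<forall>\<^sub>F s in at_top. 0 < a c s"
      using a_top[OF c_pos] by (auto simp: filterlim_at_top_dense)
    moreover have "\<forall>\<^sub>F s in at_top. c powr (- s) * exp ((c - 1) * m (a c s)) \<le> exp (- (k c * s))"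
      using c by (intro chernoff) auto
    moreover have "\<forall>\<^sub>F s in at_top. 0 < G (a c s)"
      by (rule eventually_compose_filterlim[OF Gpos a_top[OF c(2)]])
    ultimately show ?thesis using Hpos eventually_gt_at_top[of 0]
    proof eventually_elim
      case (elim s)
      have "H (inverse (c\<^sup>2) * s) * (1 - exp (- (k c * s))) \<le>
          G (a c s) * (1 - c powr (- s) * exp ((c - 1) * m (a c s)))"
        using elim(3,4) unfolding H_def a_c[symmetric] by (intro mult_left_mono) auto
      also have "\<dots> \<le> T s" by (rule lower[OF c(2,3) elim(2,6)])
      finally have "H (inverse (c\<^sup>2) * s) * (1 - exp (- (k c * s))) / H s \<le> T s / H s"
        using elim(5) by (intro divide_right_mono) auto
      then have "H (inverse (c\<^sup>2) * s) / H s * (1 - exp (- (k c * s))) \<le> T s / H s"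
        by simp
      then show ?case using elim(1) by linarith
    qed
  qed
  have TH: "((\<lambda>s. T s / H s) \<longlongrightarrow> 1) at_top"
    by (rule order_tendstoI) (use up lo in auto)
  have "\<forall>\<^sub>F s in at_top. 0 < T s"
    using lo[of 0, simplified] Hpos by eventually_elim (simp add: zero_less_divide_iff)
  moreover have "((\<lambda>s. T (c * s) / T s) \<longlongrightarrow> c powr (- (\<rho> / \<beta>))) at_top" if "0 < c" for c
  proof -
    have c_top: "filterlim (\<lambda>s. c * s) at_top at_top"
      by (rule filterlim_tendsto_pos_mult_at_top[OF tendsto_const that filterlim_ident])
    have "((\<lambda>s. T (c * s) / H (c * s) * (H (c * s) / H s) / (T s / H s)) \<longlongrightarrow>
        1 * c powr (- (\<rho> / \<beta>)) / 1) at_top"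
      by (intro tendsto_intros filterlim_compose[OF TH c_top] Hlim TH that) simp
    moreover have "\<forall>\<^sub>F s in at_top. T (c * s) / H (c * s) * (H (c * s) / H s) / (T s / H s) = T (c * s) / T s"
      using Hpos eventually_compose_filterlim[OF Hpos c_top] by eventually_elim simp
    ultimately have "((\<lambda>s. T (c * s) / T s) \<longlongrightarrow> 1 * c powr (- (\<rho> / \<beta>)) / 1) at_top"
      by (rule Lim_transform_eventually)
    then show ?thesis by simp
  qed
  ultimately show ?thesis by (simp add: regularly_varying_def)
qed

section \<open>The quenched law of a degree\<close>

text \<open>\<open>bernoulli_pmf\<close> truncates its parameter to the unit interval; keeping this truncation
  explicit avoids a side condition on the signs of the weights in the exact computations.\<close>

definition clip :: "real \<Rightarrow> real" where "clip p = min 1 (max 0 p)"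

lemma clip_bounds [simp]: "0 \<le> clip p" "clip p \<le> 1"
  by (auto simp: clip_def)

lemma clip_mono: "p \<le> q \<Longrightarrow> clip p \<le> clip q"
  by (auto simp: clip_def)

lemma borel_measurable_clip [measurable]: "clip \<in> borel_measurable borel"
  unfolding clip_def[abs_def] by measurable

lemma bernoulli_pmf_clip: "bernoulli_pmf (clip p) = bernoulli_pmf p"
  by (rule pmf_eqI) (simp add: bernoulli_pmf.rep_eq clip_def)

text \<open>The dependence on \<open>p\<close> is explicit, so measurability of a Bernoulli law in
  its parameter reduces to that of \<open>clip\<close>.\<close>

lemma emeasure_bernoulli_pmf:
  "emeasure (bernoulli_pmf p) X =
     (if True \<in> X then ennreal (clip p) else 0) + (if False \<in> X then ennreal (1 - clip p) else 0)"
proof -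
  have "emeasure (bernoulli_pmf p) X = (\<Sum>b\<in>X. ennreal (pmf (bernoulli_pmf (clip p)) b))"
    by (simp add: bernoulli_pmf_clip emeasure_measure_pmf_finite)
  also have "\<dots> = (\<Sum>b\<in>UNIV. if b \<in> X then ennreal (pmf (bernoulli_pmf (clip p)) b) else 0)"
    by (simp add: sum.If_cases)
  finally show ?thesis by (simp add: UNIV_bool)
qed

lemma (in product_prob_space) nn_integral_PiM_restrict:
  assumes "finite J" "J \<subseteq> I" "f \<in> borel_measurable (PiM J M)"
  shows "(\<integral>\<^sup>+\<omega>. f (restrict \<omega> J) \<partial>PiM I M) = (\<integral>\<^sup>+\<omega>. f \<omega> \<partial>PiM J M)"
  using assms distr_PiM_restrict_finite[OF assms(1,2)]
  by (metis measurable_restrict_subset nn_integral_distr)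

text \<open>Fubini is applied to the finite marginal on \<open>J\<close>, since the index set of the
  full product may be infinite.\<close>

lemma (in product_prob_space) nn_integral_PiM_prod:
  fixes f :: "'i \<Rightarrow> 'a \<Rightarrow> ennreal"
  assumes J: "finite J" "J \<subseteq> I" and f[measurable]: "\<And>i. i \<in> J \<Longrightarrow> f i \<in> borel_measurable (M i)"
  shows "(\<integral>\<^sup>+\<omega>. (\<Prod>i\<in>J. f i (\<omega> i)) \<partial>PiM I M) = (\<Prod>i\<in>J. \<integral>\<^sup>+y. f i y \<partial>M i)"
proof -
  have "(\<integral>\<^sup>+\<omega>. (\<Prod>i\<in>J. f i (restrict \<omega> J i)) \<partial>PiM I M) = (\<integral>\<^sup>+\<omega>. (\<Prod>i\<in>J. f i (\<omega> i)) \<partial>PiM J M)"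
    by (rule nn_integral_PiM_restrict[OF J]) measurable
  then show ?thesis using J f by (simp add: product_nn_integral_prod)
qed

section \<open>The random graph as a kernel from weights to edges\<close>

definition edge_law :: "real \<Rightarrow> 'a::real_normed_vector set \<Rightarrow> ('a \<Rightarrow> real) \<Rightarrow> ('a set \<Rightarrow> bool) measure" where
  "edge_law \<alpha> V w = (\<Pi>\<^sub>M e\<in>vertex_pairs V. measure_pmf (bernoulli_pmf (edge_prob \<alpha> w e)))"

lemma sets_edge_law [measurable_cong]:
  "sets (edge_law \<alpha> V w) = sets (\<Pi>\<^sub>M e\<in>vertex_pairs V. count_space UNIV)"
  unfolding edge_law_def by (intro sets_PiM_cong) auto

lemma measurable_edge_prob [measurable]:
  assumes [measurable_cong]: "sets W = sets borel" and "e \<in> vertex_pairs V"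
  shows "(\<lambda>w. edge_prob \<alpha> w e) \<in> borel_measurable (\<Pi>\<^sub>M x\<in>V. W)"
proof -
  obtain x y where e: "e = {x, y}" and [measurable]: "x \<in> V" "y \<in> V" and "x \<noteq> y"
    using assms(2) by (auto simp: vertex_pairs_def)
  show ?thesis unfolding e edge_prob_pair[OF \<open>x \<noteq> y\<close>] by measurable
qed

text \<open>Measurability of the kernel is what makes integrals against the \<open>bind\<close> in
  \<open>quenched_law\<close> computable. Cylinders form a generating system stable under
  intersection, and on a cylinder the law is a finite product of Bernoulli probabilities, each
  measurable in the weights.\<close>

lemma measurable_edge_law:
  assumes W: "sets W = sets borel"
  shows "edge_law \<alpha> V \<in> (\<Pi>\<^sub>M x\<in>V. W) \<rightarrow>\<^sub>M prob_algebra (\<Pi>\<^sub>M e\<in>vertex_pairs V. count_space UNIV)"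
proof (rule measurable_prob_algebra_generated[OF sets_PiM Int_stable_prod_algebra prod_algebra_sets_into_space])
  fix w show "prob_space (edge_law \<alpha> V w)"
    unfolding edge_law_def by (intro prob_space_PiM prob_space_measure_pmf)
  show "sets (edge_law \<alpha> V w) = sets (\<Pi>\<^sub>M e\<in>vertex_pairs V. count_space UNIV)"
    by (rule sets_edge_law)
next
  fix A assume "A \<in> prod_algebra (vertex_pairs V) (\<lambda>_. count_space (UNIV :: bool set))"
  then obtain J X where A: "A = prod_emb (vertex_pairs V) (\<lambda>_. count_space UNIV) J (Pi\<^sub>E J X)"
      and J: "finite J" "J \<subseteq> vertex_pairs V"
    by (elim prod_algebraE)
  have "emeasure (edge_law \<alpha> V w) A = (\<Prod>e\<in>J. emeasure (bernoulli_pmf (edge_prob \<alpha> w e)) (X e))" for w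
  proof -
    have "A = prod_emb (vertex_pairs V) (\<lambda>e. measure_pmf (bernoulli_pmf (edge_prob \<alpha> w e))) J (Pi\<^sub>E J X)"
      unfolding A by (simp add: prod_emb_def)
    then show ?thesis
      unfolding edge_law_def using J by (simp add: emeasure_PiM_emb prob_space_measure_pmf)
  qed
  moreover have "(\<lambda>w. \<Prod>e\<in>J. emeasure (bernoulli_pmf (edge_prob \<alpha> w e)) (X e)) \<in> borel_measurable (\<Pi>\<^sub>M x\<in>V. W)"
  proof (rule borel_measurable_prod_ennreal)
    fix e assume "e \<in> J"
    then have [measurable]: "(\<lambda>w. edge_prob \<alpha> w e) \<in> borel_measurable (\<Pi>\<^sub>M x\<in>V. W)"
      using J W by (intro measurable_edge_prob) auto
    show "(\<lambda>w. emeasure (bernoulli_pmf (edge_prob \<alpha> w e)) (X e)) \<in> borel_measurable (\<Pi>\<^sub>M x\<in>V. W)"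
      unfolding emeasure_bernoulli_pmf by measurable
  qed
  ultimately show "(\<lambda>w. emeasure (edge_law \<alpha> V w) A) \<in> borel_measurable (\<Pi>\<^sub>M x\<in>V. W)" by simp
qed

context
  fixes W :: "real measure" and V :: "'a::real_normed_vector set" and \<alpha> :: real
  assumes W: "real_distribution W"
begin

interpretation W: real_distribution W by (rule W)

lemma measurable_graph_kernel:
  "(\<lambda>w. distr (edge_law \<alpha> V w) (graph_space V W) (Pair w)) \<in>
     (\<Pi>\<^sub>M x\<in>V. W) \<rightarrow>\<^sub>M subprob_algebra (graph_space V W)"
proof (rule measurable_distr2)
  show "case_prod Pair \<in> (\<Pi>\<^sub>M x\<in>V. W) \<Otimes>\<^sub>M (\<Pi>\<^sub>M e\<in>vertex_pairs V. count_space UNIV) \<rightarrow>\<^sub>M graph_space V W"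
    by (simp add: graph_space_def)
  show "edge_law \<alpha> V \<in> (\<Pi>\<^sub>M x\<in>V. W) \<rightarrow>\<^sub>M subprob_algebra (\<Pi>\<^sub>M e\<in>vertex_pairs V. count_space UNIV)"
    by (rule measurable_prob_algebraD[OF measurable_edge_law]) simp
qed

lemma prob_space_weights: "prob_space (\<Pi>\<^sub>M x\<in>V. W)"
  by (intro prob_space_PiM W.prob_space_axioms)

lemma quenched_law_edge_law:
  "quenched_law W \<alpha> V = (\<Pi>\<^sub>M x\<in>V. W) \<bind> (\<lambda>w. distr (edge_law \<alpha> V w) (graph_space V W) (Pair w))"
  by (simp add: quenched_law_def edge_law_def)

lemma sets_quenched_law [measurable_cong]: "sets (quenched_law W \<alpha> V) = sets (graph_space V W)"
  unfolding quenched_law_edge_law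
  by (rule sets_bind) (auto simp: prob_space.not_empty[OF prob_space_weights])

lemma measurable_Pair_edge_law [measurable]:
  assumes "w \<in> space (\<Pi>\<^sub>M x\<in>V. W)"
  shows "Pair w \<in> edge_law \<alpha> V w \<rightarrow>\<^sub>M graph_space V W"
  unfolding graph_space_def using assms by (intro measurable_Pair) measurable

lemma nn_integral_quenched_law:
  assumes [measurable]: "f \<in> borel_measurable (graph_space V W)"
  shows "(\<integral>\<^sup>+g. f g \<partial>quenched_law W \<alpha> V) =
    (\<integral>\<^sup>+w. \<integral>\<^sup>+b. f (w, b) \<partial>edge_law \<alpha> V w \<partial>(\<Pi>\<^sub>M x\<in>V. W))"
  unfolding quenched_law_edge_law nn_integral_bind[OF assms measurable_graph_kernel]
  by (intro nn_integral_cong) (simp add: nn_integral_distr)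

lemma prob_space_quenched_law: "prob_space (quenched_law W \<alpha> V)"
proof
  have "emeasure (quenched_law W \<alpha> V) (space (quenched_law W \<alpha> V)) = (\<integral>\<^sup>+g. 1 \<partial>quenched_law W \<alpha> V)"
    by simp
  also have "\<dots> = (\<integral>\<^sup>+w. \<integral>\<^sup>+b. 1 \<partial>edge_law \<alpha> V w \<partial>(\<Pi>\<^sub>M x\<in>V. W))"
    by (rule nn_integral_quenched_law) simp
  also have "\<dots> = (\<integral>\<^sup>+w. 1 \<partial>(\<Pi>\<^sub>M x\<in>V. W))"
    by (intro nn_integral_cong) (simp add: edge_law_def prob_space.emeasure_space_1 prob_space_PiM prob_space_measure_pmf)
  also have "\<dots> = 1"
    using prob_space.emeasure_space_1[OF prob_space_weights] by simp
  finally show "emeasure (quenched_law W \<alpha> V) (space (quenched_law W \<alpha> V)) = 1" .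
qed

section \<open>Exponential moments of the degree into a finite vertex set\<close>

definition mean_edge_prob :: "'a \<Rightarrow> 'a \<Rightarrow> real \<Rightarrow> real" where
  "mean_edge_prob x y u = (\<integral>v. clip (1 - exp (- (u * v / norm (x - y) powr \<alpha>))) \<partial>W)"

lemma integrable_clip: "f \<in> borel_measurable W \<Longrightarrow> integrable W (\<lambda>v. clip (f v))"
  by (rule W.integrable_const_bound[where B=1]) auto

lemma mean_edge_prob_nonneg: "0 \<le> mean_edge_prob x y u"
  unfolding mean_edge_prob_def by simp

text \<open>This lets a whole range of weights at \<open>x\<close> be replaced by its endpoint in
  the exponential bounds.\<close>

lemma mean_edge_prob_mono:
  assumes "AE v in W. 0 < v" and "u \<le> u'"
  shows "mean_edge_prob x y u \<le> mean_edge_prob x y u'"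
  unfolding mean_edge_prob_def
proof (intro integral_mono_AE integrable_clip)
  show "AE v in W. clip (1 - exp (- (u * v / norm (x - y) powr \<alpha>))) \<le>
      clip (1 - exp (- (u' * v / norm (x - y) powr \<alpha>)))"
    using assms(1)
  proof eventually_elim
    case (elim v)
    then have "u * v / norm (x - y) powr \<alpha> \<le> u' * v / norm (x - y) powr \<alpha>"
      using assms(2) by (intro divide_right_mono mult_right_mono) auto
    then show ?case by (intro clip_mono) simp
  qed
qed measurable

lemma measurable_mean_edge_prob [measurable]: "mean_edge_prob x y \<in> borel_measurable borel"
  unfolding mean_edge_prob_def[abs_def] by measurable

lemma measurable_graph_space_weight [measurable]:
  "x \<in> V \<Longrightarrow> (\<lambda>g. fst g x) \<in> borel_measurable (graph_space V W)"
  unfolding graph_space_def by measurable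

lemma measurable_graph_space_edge [measurable]:
  "e \<in> vertex_pairs V \<Longrightarrow> (\<lambda>g. snd g e) \<in> graph_space V W \<rightarrow>\<^sub>M count_space UNIV"
  unfolding graph_space_def by measurable

text \<open>Given all weights, the edges from \<open>x\<close> to \<open>F\<close> are independent,
  so the edge integral is a product whose factor for \<open>y\<close> involves only the weights of
  \<open>x\<close> and \<open>y\<close>. Given the weight \<open>u\<close> of \<open>x\<close>, the
  other weights are independent and enter one factor each, so the product survives their
  integration. The set \<open>A\<close> restricts the weight of \<open>x\<close>.\<close>

lemma degree_generating_function:
  assumes x: "x \<in> V" and F: "finite F" "F \<subseteq> V - {x}" and [measurable]: "A \<in> sets borel" and "0 < c"
  shows "(\<integral>\<^sup>+g. indicator A (fst g x) * (\<Prod>y\<in>F. if snd g {x, y} then ennreal c else 1) \<partial>quenched_law W \<alpha> V) =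
    (\<integral>\<^sup>+u. indicator A u * (\<Prod>y\<in>F. ennreal (1 + (c - 1) * mean_edge_prob x y u)) \<partial>W)"
proof -
  have pairs: "{x, y} \<in> vertex_pairs V" if "y \<in> F" for y
    using that x F by (auto simp: vertex_pairs_def)
  \<comment> \<open>The conditional mean of \<open>c\<close> to the power of the edge indicator,
    given the weights \<open>u\<close> and \<open>v\<close> of its endpoints.\<close>
  define r where "r y u v = 1 + (c - 1) * clip (1 - exp (- (u * v / norm (x - y) powr \<alpha>)))" for y u v
  have r_nonneg: "0 \<le> r y u v" for y u v
  proof -
    have "r y u v = (1 - clip (1 - exp (- (u * v / norm (x - y) powr \<alpha>)))) +
        c * clip (1 - exp (- (u * v / norm (x - y) powr \<alpha>)))"
      by (simp add: r_def algebra_simps)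
    then show ?thesis using \<open>0 < c\<close> by simp
  qed
  have r_meas[measurable]: "(\<lambda>p. r y (fst p) (snd p)) \<in> borel_measurable (borel \<Otimes>\<^sub>M borel)" for y
    unfolding r_def by measurable
  have inner: "(\<integral>\<^sup>+b. (\<Prod>y\<in>F. if b {x, y} then ennreal c else 1) \<partial>edge_law \<alpha> V w) =
      (\<Prod>y\<in>F. ennreal (r y (w x) (w y)))" for w
  proof -
    interpret E: product_prob_space "\<lambda>e. measure_pmf (bernoulli_pmf (edge_prob \<alpha> w e))" "vertex_pairs V"
      by unfold_locales
    \<comment> \<open>Distinct neighbours of \<open>x\<close> use distinct unordered pairs, hence
      distinct coordinates of the edge product.\<close>
    have inj: "inj_on (\<lambda>y. {x, y}) F"
      by (auto simp: inj_on_def doubleton_eq_iff)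
    have "(\<integral>\<^sup>+b. (\<Prod>y\<in>F. if b {x, y} then ennreal c else 1) \<partial>edge_law \<alpha> V w) =
        (\<integral>\<^sup>+b. (\<Prod>e\<in>(\<lambda>y. {x, y}) ` F. if b e then ennreal c else 1) \<partial>edge_law \<alpha> V w)"
      by (simp add: prod.reindex[OF inj])
    also have "\<dots> = (\<Prod>e\<in>(\<lambda>y. {x, y}) ` F. \<integral>\<^sup>+b. (if b then ennreal c else 1) \<partial>bernoulli_pmf (edge_prob \<alpha> w e))"
      unfolding edge_law_def using F pairs
      by (intro E.nn_integral_PiM_prod[where f="\<lambda>_ b. if b then ennreal c else 1"]) auto
    also have "\<dots> = (\<Prod>y\<in>F. \<integral>\<^sup>+b. (if b then ennreal c else 1) \<partial>bernoulli_pmf (clip (edge_prob \<alpha> w {x, y})))"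
      by (simp add: prod.reindex[OF inj] bernoulli_pmf_clip)
    also have "\<dots> = (\<Prod>y\<in>F. ennreal (r y (w x) (w y)))"
    proof (rule prod.cong[OF refl])
      fix y assume "y \<in> F"
      then have "x \<noteq> y" using F by auto
      show "(\<integral>\<^sup>+b. (if b then ennreal c else 1) \<partial>bernoulli_pmf (clip (edge_prob \<alpha> w {x, y}))) = ennreal (r y (w x) (w y))"
        using \<open>0 < c\<close>
        by (simp add: edge_prob_pair[OF \<open>x \<noteq> y\<close>] r_def ennreal_mult'[symmetric] ennreal_plus[symmetric] algebra_simps del: ennreal_plus)
    qed
    finally show ?thesis .
  qed
  interpret V: product_prob_space "\<lambda>_. W" V by unfold_locales
  define f where "f w = indicator A (w x) * (\<Prod>y\<in>F. ennreal (r y (w x) (w y)))" for w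
  have [measurable]: "(\<lambda>w. r y (w x) (w y)) \<in> borel_measurable (\<Pi>\<^sub>M y\<in>insert x F. W)" if "y \<in> F" for y
    using measurable_compose[OF _ r_meas[of y], of "\<lambda>w. (w x, w y)" "\<Pi>\<^sub>M y\<in>insert x F. W"] that by simp
  have f_meas[measurable]: "f \<in> borel_measurable (\<Pi>\<^sub>M y\<in>insert x F. W)"
    unfolding f_def by measurable
  have "(\<integral>\<^sup>+g. indicator A (fst g x) * (\<Prod>y\<in>F. if snd g {x, y} then ennreal c else 1) \<partial>quenched_law W \<alpha> V) =
      (\<integral>\<^sup>+w. \<integral>\<^sup>+b. indicator A (w x) * (\<Prod>y\<in>F. if b {x, y} then ennreal c else 1) \<partial>edge_law \<alpha> V w \<partial>(\<Pi>\<^sub>M x\<in>V. W))"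
    using x pairs by (subst nn_integral_quenched_law) auto
  also have "\<dots> = (\<integral>\<^sup>+w. f w \<partial>(\<Pi>\<^sub>M x\<in>V. W))"
  proof (intro nn_integral_cong)
    fix w
    have "(\<lambda>b. \<Prod>y\<in>F. if b {x, y} then ennreal c else 1) \<in> borel_measurable (edge_law \<alpha> V w)"
      using pairs by measurable
    then show "(\<integral>\<^sup>+b. indicator A (w x) * (\<Prod>y\<in>F. if b {x, y} then ennreal c else 1) \<partial>edge_law \<alpha> V w) = f w"
      by (simp add: nn_integral_cmult inner f_def)
  qed
  also have "\<dots> = (\<integral>\<^sup>+w. f (restrict w (insert x F)) \<partial>(\<Pi>\<^sub>M x\<in>V. W))"
    by (simp add: f_def cong: prod.cong)
  also have "\<dots> = (\<integral>\<^sup>+w. f w \<partial>(\<Pi>\<^sub>M y\<in>insert x F. W))"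
    using x F by (intro V.nn_integral_PiM_restrict) auto
  \<comment> \<open>The weight of \<open>x\<close>, shared by all factors, is left to the outer
    integral; for fixed \<open>u\<close> the inner integrand splits over separate
    coordinates.\<close>
  also have "\<dots> = (\<integral>\<^sup>+u. \<integral>\<^sup>+w. f (w(x := u)) \<partial>(\<Pi>\<^sub>M y\<in>F. W) \<partial>W)"
    using F by (intro V.product_nn_integral_insert_rev) auto
  also have "\<dots> = (\<integral>\<^sup>+u. indicator A u * (\<Prod>y\<in>F. ennreal (1 + (c - 1) * mean_edge_prob x y u)) \<partial>W)"
  proof (intro nn_integral_cong)
    fix u
    have r_u[measurable]: "r y u \<in> borel_measurable borel" for y
      unfolding r_def by measurable
    have r_int: "integrable W (r y u)" for y
      unfolding r_def by (intro Bochner_Integration.integrable_add integrable_mult_right integrable_clip) auto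
    have "(\<integral>\<^sup>+w. f (w(x := u)) \<partial>(\<Pi>\<^sub>M y\<in>F. W)) =
        (\<integral>\<^sup>+w. indicator A u * (\<Prod>y\<in>F. ennreal (r y u (w y))) \<partial>(\<Pi>\<^sub>M y\<in>F. W))"
      unfolding f_def using F by (intro nn_integral_cong arg_cong2[where f="(*)"] prod.cong) auto
    also have "\<dots> = indicator A u * (\<Prod>y\<in>F. \<integral>\<^sup>+v. ennreal (r y u v) \<partial>W)"
      using F V.product_nn_integral_prod[of F "\<lambda>y v. ennreal (r y u v)"] by (simp add: nn_integral_cmult)
    also have "(\<lambda>y. \<integral>\<^sup>+v. ennreal (r y u v) \<partial>W) = (\<lambda>y. ennreal (1 + (c - 1) * mean_edge_prob x y u))"
    proof
      fix y
      have "(\<integral>v. r y u v \<partial>W) = 1 + (c - 1) * mean_edge_prob x y u"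
        unfolding r_def mean_edge_prob_def
        by (subst Bochner_Integration.integral_add) (auto intro!: integrable_clip simp: W.prob_space[unfolded W.space_eq_univ])
      then show "(\<integral>\<^sup>+v. ennreal (r y u v) \<partial>W) = ennreal (1 + (c - 1) * mean_edge_prob x y u)"
        using r_nonneg r_int by (subst nn_integral_eq_integral) auto
    qed
    finally show "(\<integral>\<^sup>+w. f (w(x := u)) \<partial>(\<Pi>\<^sub>M y\<in>F. W)) =
        indicator A u * (\<Prod>y\<in>F. ennreal (1 + (c - 1) * mean_edge_prob x y u))" .
  qed
  finally show ?thesis .
qed


text \<open>For finite \<open>F\<close> this is a faithful count; along an exhaustion of the other
  vertices it increases to \<open>vertex_degree\<close>.\<close>

definition partial_degree :: "'a set \<Rightarrow> 'a \<Rightarrow> ('a \<Rightarrow> real) \<times> ('a set \<Rightarrow> bool) \<Rightarrow> nat" where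
  "partial_degree F x g = card {y \<in> F. snd g {x, y}}"

lemma prod_edges_eq_power:
  assumes "finite F" and "0 < c"
  shows "(\<Prod>y\<in>F. if snd g {x, y} then ennreal c else 1) = ennreal (c powr real (partial_degree F x g))"
proof -
  have "(\<Prod>y\<in>F. if snd g {x, y} then ennreal c else 1) = ennreal c ^ partial_degree F x g"
    using assms by (simp add: prod.If_cases partial_degree_def Int_def)
  then show ?thesis using assms by (simp add: powr_realpow ennreal_power)
qed

lemma measurable_partial_degree [measurable]:
  assumes x: "x \<in> V" and F: "finite F" "F \<subseteq> V - {x}"
  shows "partial_degree F x \<in> graph_space V W \<rightarrow>\<^sub>M count_space UNIV"
proof -
  have "{x, y} \<in> vertex_pairs V" if "y \<in> F" for y
    using that x F by (auto simp: vertex_pairs_def)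
  then have "(\<lambda>g. \<Sum>y\<in>F. if snd g {x, y} then 1 else 0 :: nat) \<in> graph_space V W \<rightarrow>\<^sub>M count_space UNIV"
    by measurable
  also have "(\<lambda>g. \<Sum>y\<in>F. if snd g {x, y} then 1 else 0) = partial_degree F x"
    using F by (auto simp: partial_degree_def fun_eq_iff sum.If_cases Int_def)
  finally show ?thesis .
qed

text \<open>The hypothesis on \<open>A\<close> says that replacing the weight \<open>u\<close> by
  \<open>a\<close> can only increase \<open>(c - 1) * mean_edge_prob x y u\<close>, for tilts on
  either side of 1. With \<open>1 + z \<le> exp z\<close> the bound no longer depends on
  \<open>u\<close>, and integrating over \<open>A\<close> leaves the factor
  \<open>measure W A\<close>.\<close>

lemma generating_function_bound:
  assumes pos: "AE v in W. 0 < v" and x: "x \<in> V" and F: "finite F" "F \<subseteq> V - {x}"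
    and [measurable]: "A \<in> sets borel" and "0 < c"
    and A: "\<And>u. u \<in> A \<Longrightarrow> (c \<le> 1 \<and> a \<le> u) \<or> (1 \<le> c \<and> u \<le> a)"
  shows "(\<integral>\<^sup>+g. indicator A (fst g x) * ennreal (c powr real (partial_degree F x g)) \<partial>quenched_law W \<alpha> V) \<le>
    ennreal (measure W A * exp ((c - 1) * (\<Sum>y\<in>F. mean_edge_prob x y a)))"
proof -
  have *: "1 + (c - 1) * mean_edge_prob x y u \<le> exp ((c - 1) * mean_edge_prob x y a)" if "u \<in> A" for u y
  proof -
    have "(c - 1) * mean_edge_prob x y u \<le> (c - 1) * mean_edge_prob x y a"
      using A[OF that] mean_edge_prob_mono[OF pos] by (auto intro: mult_left_mono mult_left_mono_neg)
    moreover have "1 + (c - 1) * mean_edge_prob x y a \<le> exp ((c - 1) * mean_edge_prob x y a)"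
      by (rule exp_ge_add_one_self)
    ultimately show ?thesis by linarith
  qed
  have "(\<integral>\<^sup>+g. indicator A (fst g x) * ennreal (c powr real (partial_degree F x g)) \<partial>quenched_law W \<alpha> V) =
      (\<integral>\<^sup>+u. indicator A u * (\<Prod>y\<in>F. ennreal (1 + (c - 1) * mean_edge_prob x y u)) \<partial>W)"
    using degree_generating_function[OF x F \<open>A \<in> sets borel\<close> \<open>0 < c\<close>]
    by (simp add: prod_edges_eq_power F \<open>0 < c\<close>)
  also have "\<dots> \<le> (\<integral>\<^sup>+u. indicator A u * (\<Prod>y\<in>F. ennreal (exp ((c - 1) * mean_edge_prob x y a))) \<partial>W)"
  proof (intro nn_integral_mono)
    fix u
    show "indicator A u * (\<Prod>y\<in>F. ennreal (1 + (c - 1) * mean_edge_prob x y u)) \<le>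
        indicator A u * (\<Prod>y\<in>F. ennreal (exp ((c - 1) * mean_edge_prob x y a)))"
    proof (cases "u \<in> A")
      case True
      then show ?thesis by (intro mult_left_mono prod_mono_ennreal ennreal_leI *) auto
    qed simp
  qed
  also have "\<dots> = emeasure W A * ennreal (exp ((c - 1) * (\<Sum>y\<in>F. mean_edge_prob x y a)))"
    by (simp add: nn_integral_multc prod_ennreal exp_sum F sum_distrib_left)
  finally show ?thesis by (simp add: W.emeasure_eq_measure ennreal_mult)
qed

lemma measure_weight:
  assumes x: "x \<in> V" and A[measurable]: "A \<in> sets borel"
  shows "measure (quenched_law W \<alpha> V) {g \<in> space (quenched_law W \<alpha> V). fst g x \<in> A} = measure W A"
proof -
  have *: "{g \<in> space (quenched_law W \<alpha> V). fst g x \<in> A} \<in> sets (quenched_law W \<alpha> V)"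
    using x by measurable
  have "emeasure (quenched_law W \<alpha> V) {g \<in> space (quenched_law W \<alpha> V). fst g x \<in> A} =
      (\<integral>\<^sup>+g. indicator A (fst g x) \<partial>quenched_law W \<alpha> V)"
    by (subst nn_integral_indicator[OF *, symmetric]) (auto intro!: nn_integral_cong simp: indicator_def)
  also have "\<dots> = emeasure W A"
    \<comment> \<open>With no neighbours the product is empty and the generating function reduces to
      the law of the weight at \<open>x\<close>.\<close>
    using degree_generating_function[OF x, of "{}" A 1] by simp
  finally show ?thesis by (simp add: measure_def)
qed

text \<open>Split at the weight \<open>a\<close>: a degree above \<open>s\<close> needs a weight
  above \<open>a\<close>, or occurs in spite of a smaller one; a weight above \<open>a\<close>
  forces a degree above \<open>s\<close>, except on an unlikely event. Markov's inequality for
  \<open>c\<close> to the power of the degree bounds both exceptional events by \<epsilon> times the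
  mass of their weight range.\<close>

lemma partial_degree_tail:
  fixes a s :: real
  assumes pos: "AE v in W. 0 < v" and x: "x \<in> V" and F: "finite F" "F \<subseteq> V - {x}" and "0 < c"
  defines "Q \<equiv> quenched_law W \<alpha> V"
  defines "\<epsilon> \<equiv> c powr (- s) * exp ((c - 1) * (\<Sum>y\<in>F. mean_edge_prob x y a))"
  shows "1 \<le> c \<Longrightarrow> measure Q {g \<in> space Q. real (partial_degree F x g) > s} \<le> measure W {a<..} + \<epsilon>"
    and "c \<le> 1 \<Longrightarrow> measure W {a<..} * (1 - \<epsilon>) \<le> measure Q {g \<in> space Q. real (partial_degree F x g) > s}"
proof -
  note [measurable] = x measurable_partial_degree[OF x F]
  interpret Q: prob_space Q unfolding Q_def by (rule prob_space_quenched_law)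
  have [measurable_cong]: "sets Q = sets (graph_space V W)"
    unfolding Q_def by (rule sets_quenched_law)
  have weight: "measure Q {g \<in> space Q. fst g x \<in> A} = measure W A" if "A \<in> sets borel" for A
    unfolding Q_def using x that by (rule measure_weight)
  \<comment> \<open>Phrasing the deviation as \<open>c powr s \<le> c powr real n\<close> covers
    large degrees for \<open>c \<ge> 1\<close> and small ones for \<open>c \<le> 1\<close> in one
    argument.\<close>
  have markov: "measure Q {g \<in> space Q. fst g x \<in> A \<and> P (partial_degree F x g)} \<le> measure W A * \<epsilon>"
    if [measurable]: "A \<in> sets borel" and P: "\<And>n. P n \<Longrightarrow> c powr s \<le> c powr real n"
      and A: "\<And>u. u \<in> A \<Longrightarrow> (c \<le> 1 \<and> a \<le> u) \<or> (1 \<le> c \<and> u \<le> a)" for A P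
  proof -
    let ?E = "{g \<in> space Q. fst g x \<in> A \<and> P (partial_degree F x g)}"
    have "emeasure Q ?E = (\<integral>\<^sup>+g. indicator ?E g \<partial>Q)"
      by (rule nn_integral_indicator[symmetric]) measurable
    also have "\<dots> \<le> (\<integral>\<^sup>+g. ennreal (c powr (- s)) *
        (indicator A (fst g x) * ennreal (c powr real (partial_degree F x g))) \<partial>Q)"
    proof (intro nn_integral_mono)
      fix g
      have "1 \<le> c powr (- s) * c powr real n" if "P n" for n
        using P[OF that] \<open>0 < c\<close> by (simp add: powr_minus field_simps)
      then show "indicator ?E g \<le> ennreal (c powr (- s)) *
          (indicator A (fst g x) * ennreal (c powr real (partial_degree F x g)))"
        by (auto simp: indicator_def ennreal_mult[symmetric] simp del: ennreal_1 simp: ennreal_1[symmetric] intro!: ennreal_leI)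
    qed
    also have "\<dots> = ennreal (c powr (- s)) * (\<integral>\<^sup>+g. indicator A (fst g x) * ennreal (c powr real (partial_degree F x g)) \<partial>Q)"
      by (rule nn_integral_cmult) measurable
    also have "\<dots> \<le> ennreal (c powr (- s)) *
        ennreal (measure W A * exp ((c - 1) * (\<Sum>y\<in>F. mean_edge_prob x y a)))"
      unfolding Q_def by (intro mult_left_mono generating_function_bound assms A) auto
    also have "\<dots> = ennreal (measure W A * \<epsilon>)"
      by (simp add: \<epsilon>_def ennreal_mult[symmetric] ac_simps)
    finally show ?thesis by (simp add: Q.emeasure_eq_measure \<epsilon>_def)
  qed
  {
    assume "1 \<le> c"
    have "measure Q {g \<in> space Q. real (partial_degree F x g) > s} \<le>
        measure Q ({g \<in> space Q. fst g x \<in> {a<..}} \<union>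
          {g \<in> space Q. fst g x \<in> {..a} \<and> real (partial_degree F x g) > s})"
      by (intro Q.finite_measure_mono) auto
    also have "\<dots> \<le> measure Q {g \<in> space Q. fst g x \<in> {a<..}} +
        measure Q {g \<in> space Q. fst g x \<in> {..a} \<and> real (partial_degree F x g) > s}"
      by (intro measure_Un_le) measurable
    also have "\<dots> \<le> measure W {a<..} + measure W {..a} * \<epsilon>"
      using \<open>1 \<le> c\<close> by (intro add_mono markov) (auto simp: weight[of "{a<..}", simplified] intro!: powr_mono)
    also have "\<dots> \<le> measure W {a<..} + 1 * \<epsilon>"
      by (intro add_left_mono mult_right_mono) (auto simp: \<epsilon>_def)
    finally show "measure Q {g \<in> space Q. real (partial_degree F x g) > s} \<le> measure W {a<..} + \<epsilon>"
      by simp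
  next
    assume "c \<le> 1"
    have "measure W {a<..} = measure Q {g \<in> space Q. fst g x \<in> {a<..}}"
      by (simp add: weight[of "{a<..}", simplified])
    also have "\<dots> \<le> measure Q ({g \<in> space Q. real (partial_degree F x g) > s} \<union>
          {g \<in> space Q. fst g x \<in> {a<..} \<and> real (partial_degree F x g) \<le> s})"
      by (intro Q.finite_measure_mono) auto
    also have "\<dots> \<le> measure Q {g \<in> space Q. real (partial_degree F x g) > s} +
          measure Q {g \<in> space Q. fst g x \<in> {a<..} \<and> real (partial_degree F x g) \<le> s}"
      by (intro measure_Un_le) measurable
    also have "\<dots> \<le> measure Q {g \<in> space Q. real (partial_degree F x g) > s} + measure W {a<..} * \<epsilon>"
      using \<open>c \<le> 1\<close> \<open>0 < c\<close> by (intro add_left_mono markov) (auto intro!: powr_mono')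
    finally show "measure W {a<..} * (1 - \<epsilon>) \<le> measure Q {g \<in> space Q. real (partial_degree F x g) > s}"
      by (simp add: algebra_simps)
  }
qed

text \<open>The degree, possibly infinite, is the supremum of the partial degrees. The strict
  inequality makes the event an increasing union: a supremum exceeds \<open>s\<close> exactly when
  some member does.\<close>

lemma degree_tail_tendsto:
  fixes F :: "nat \<Rightarrow> 'a set"
  assumes x: "x \<in> V" and F: "\<And>n. finite (F n)" "incseq F" "(\<Union>n. F n) = V - {x}" and "0 \<le> s"
  defines "Q \<equiv> quenched_law W \<alpha> V"
  shows "(\<lambda>n. measure Q {g \<in> space Q. real (partial_degree (F n) x g) > s}) \<longlonglongrightarrow>
    measure Q {g \<in> space Q. vertex_degree V x g > ennreal s}"
proof -
  interpret Q: prob_space Q unfolding Q_def by (rule prob_space_quenched_law)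
  have [measurable_cong]: "sets Q = sets (graph_space V W)"
    unfolding Q_def by (rule sets_quenched_law)
  have FV: "F n \<subseteq> V - {x}" for n using F(3) by auto
  note [measurable] = measurable_partial_degree[OF x F(1) FV]
  let ?D = "\<lambda>n. {g \<in> space Q. real (partial_degree (F n) x g) > s}"
  have inc: "incseq (\<lambda>n. {y \<in> F n. snd g {x, y}})" for g
    using F(2) by (auto simp: incseq_def)
  have pd_mono: "partial_degree (F m) x g \<le> partial_degree (F n) x g" if "m \<le> n" for m n g
    unfolding partial_degree_def using incseqD[OF inc that, of g] F(1)[of n] by (intro card_mono) auto
  have "vertex_degree V x g = (SUP n. ennreal (partial_degree (F n) x g))" for g
  proof -
    have "{y \<in> V. y \<noteq> x \<and> snd g {x, y}} = (\<Union>n. {y \<in> F n. snd g {x, y}})"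
      using F(3) by auto
    then have "vertex_degree V x g = (SUP n. emeasure (count_space UNIV) {y \<in> F n. snd g {x, y}})"
      unfolding vertex_degree_def using SUP_emeasure_incseq[OF _ inc[of g], of "count_space UNIV"] by simp
    then show ?thesis
      using F(1) by (simp add: partial_degree_def ennreal_of_nat_eq_real_of_nat)
  qed
  then have "{g \<in> space Q. vertex_degree V x g > ennreal s} = (\<Union>n. ?D n)"
    using \<open>0 \<le> s\<close> by (auto simp: less_SUP_iff ennreal_less_iff)
  moreover have "(\<lambda>n. measure Q (?D n)) \<longlonglongrightarrow> measure Q (\<Union>n. ?D n)"
  proof (rule Q.finite_Lim_measure_incseq)
    show "range ?D \<subseteq> sets Q" by auto
    show "incseq ?D"
      using pd_mono by (fastforce simp: incseq_def intro: order_less_le_trans)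
  qed
  ultimately show ?thesis by simp
qed

text \<open>This will give measurability of the slowly varying factor. It is taken from the partial
  degrees, whose events are known to be measurable.\<close>

lemma degree_tail_antimono:
  fixes F :: "nat \<Rightarrow> 'a set"
  assumes x: "x \<in> V" and F: "\<And>n. finite (F n)" "incseq F" "(\<Union>n. F n) = V - {x}" and "0 \<le> s" "s \<le> t"
  defines "Q \<equiv> quenched_law W \<alpha> V"
  shows "measure Q {g \<in> space Q. vertex_degree V x g > ennreal t} \<le>
    measure Q {g \<in> space Q. vertex_degree V x g > ennreal s}"
proof -
  interpret Q: prob_space Q unfolding Q_def by (rule prob_space_quenched_law)
  have [measurable_cong]: "sets Q = sets (graph_space V W)"
    unfolding Q_def by (rule sets_quenched_law)
  have FV: "F n \<subseteq> V - {x}" for n using F(3) by auto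
  note [measurable] = measurable_partial_degree[OF x F(1) FV]
  have "0 \<le> t" using assms by simp
  have "measure Q {g \<in> space Q. real (partial_degree (F n) x g) > t} \<le>
      measure Q {g \<in> space Q. real (partial_degree (F n) x g) > s}" for n
    using \<open>s \<le> t\<close> by (intro Q.finite_measure_mono) auto
  then show ?thesis
    using degree_tail_tendsto[OF x F \<open>0 \<le> t\<close>, folded Q_def] degree_tail_tendsto[OF x F \<open>0 \<le> s\<close>, folded Q_def]
    by (intro LIMSEQ_le) auto
qed

text \<open>The finite bounds depend on \<open>F n\<close> only through the sum of averaged edge
  probabilities, so both sides have limits and the inequalities persist.\<close>

lemma degree_tail_bounds:
  fixes F :: "nat \<Rightarrow> 'a set"
  assumes pos: "AE v in W. 0 < v" and x: "x \<in> V"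
    and F: "\<And>n. finite (F n)" "incseq F" "(\<Union>n. F n) = V - {x}" and "0 \<le> s" "0 < c"
    and m: "(\<lambda>n. \<Sum>y\<in>F n. mean_edge_prob x y a) \<longlonglongrightarrow> m"
  defines "Q \<equiv> quenched_law W \<alpha> V"
  shows "1 \<le> c \<Longrightarrow> measure Q {g \<in> space Q. vertex_degree V x g > ennreal s} \<le>
      measure W {a<..} + c powr (- s) * exp ((c - 1) * m)"
    and "c \<le> 1 \<Longrightarrow> measure W {a<..} * (1 - c powr (- s) * exp ((c - 1) * m)) \<le>
      measure Q {g \<in> space Q. vertex_degree V x g > ennreal s}"
proof -
  have FV: "F n \<subseteq> V - {x}" for n using F(3) by auto
  note lim = degree_tail_tendsto[OF x F \<open>0 \<le> s\<close>, folded Q_def]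
  note bounds = partial_degree_tail[OF pos x F(1) FV \<open>0 < c\<close>, folded Q_def]
  {
    assume "1 \<le> c"
    then show "measure Q {g \<in> space Q. vertex_degree V x g > ennreal s} \<le>
        measure W {a<..} + c powr (- s) * exp ((c - 1) * m)"
      by (intro LIMSEQ_le[OF lim tendsto_add[OF tendsto_const tendsto_mult[OF tendsto_const
            tendsto_exp[OF tendsto_mult[OF tendsto_const m]]]]] exI[of _ 0] allI impI bounds)
  next
    assume "c \<le> 1"
    then show "measure W {a<..} * (1 - c powr (- s) * exp ((c - 1) * m)) \<le>
        measure Q {g \<in> space Q. vertex_degree V x g > ennreal s}"
      by (intro LIMSEQ_le[OF tendsto_mult[OF tendsto_const tendsto_diff[OF tendsto_const
            tendsto_mult[OF tendsto_const tendsto_exp[OF tendsto_mult[OF tendsto_const m]]]]] lim]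
            exI[of _ 0] allI impI bounds)
  }
qed

end

section \<open>Vertex counts in balls\<close>

text \<open>Markov's inequality for \<open>c ^ N\<close>, whose mean is
  \<open>exp ((c - 1) * lam)\<close>. The event stands for \<open>N \<ge> c * lam\<close> when
  \<open>c > 1\<close> and for \<open>N \<le> c * lam\<close> when \<open>c < 1\<close>, so one
  statement covers both deviations.\<close>

lemma poisson_chernoff:
  fixes N :: "'w \<Rightarrow> nat"
  assumes "prob_space M" and N[measurable]: "N \<in> M \<rightarrow>\<^sub>M count_space UNIV"
    and poisson: "\<And>k. measure M {\<omega> \<in> space M. N \<omega> = k} = lam ^ k / fact k * exp (- lam)"
    and "0 \<le> lam" "0 < c"
  shows "measure M {\<omega> \<in> space M. c powr (c * lam) \<le> c powr real (N \<omega>)} \<le>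
    exp (- (lam * (c * ln c - c + 1)))"
proof -
  interpret prob_space M by fact
  let ?A = "\<lambda>k. {\<omega> \<in> space M. N \<omega> = k}"
  let ?E = "{\<omega> \<in> space M. c powr (c * lam) \<le> c powr real (N \<omega>)}"
  have "emeasure M ?E = (\<integral>\<^sup>+\<omega>. indicator ?E \<omega> \<partial>M)"
    by (rule nn_integral_indicator[symmetric]) measurable
  also have "\<dots> \<le> (\<integral>\<^sup>+\<omega>. (\<Sum>k. ennreal (c powr (- (c * lam)) * c ^ k) * indicator (?A k) \<omega>) \<partial>M)"
  proof (intro nn_integral_mono)
    fix \<omega> assume \<omega>: "\<omega> \<in> space M"
    have "disjoint_family ?A" by (auto simp: disjoint_family_on_def)
    then have "(\<Sum>k. ennreal (c powr (- (c * lam)) * c ^ k) * indicator (?A k) \<omega>) =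
        ennreal (c powr (- (c * lam)) * c ^ N \<omega>)"
      using \<omega> by (intro suminf_cmult_indicator) auto
    moreover have "1 \<le> c powr (- (c * lam)) * c ^ N \<omega>" if "c powr (c * lam) \<le> c powr real (N \<omega>)"
      using that \<open>0 < c\<close> by (simp add: powr_minus powr_realpow field_simps)
    ultimately show "indicator ?E \<omega> \<le> (\<Sum>k. ennreal (c powr (- (c * lam)) * c ^ k) * indicator (?A k) \<omega>)"
      by (auto simp: indicator_def simp del: ennreal_1 simp: ennreal_1[symmetric] intro!: ennreal_leI)
  qed
  also have "\<dots> = (\<Sum>k. ennreal (c powr (- (c * lam)) * c ^ k) * emeasure M (?A k))"
    by (simp add: nn_integral_suminf nn_integral_cmult)
  also have "\<dots> = (\<Sum>k. ennreal (c powr (- (c * lam)) * exp (- lam) * ((c * lam) ^ k /\<^sub>R fact k)))"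
  proof (intro suminf_cong)
    fix k
    show "ennreal (c powr (- (c * lam)) * c ^ k) * emeasure M (?A k) =
        ennreal (c powr (- (c * lam)) * exp (- lam) * ((c * lam) ^ k /\<^sub>R fact k))"
      using \<open>0 < c\<close> \<open>0 \<le> lam\<close>
      by (simp add: emeasure_eq_measure poisson ennreal_mult[symmetric] power_mult_distrib divide_inverse mult.assoc mult.commute mult.left_commute)
  qed
  also have "\<dots> = ennreal (c powr (- (c * lam)) * exp (- lam) * exp (c * lam))"
    using \<open>0 < c\<close> \<open>0 \<le> lam\<close>
    by (intro suminf_ennreal_eq sums_mult exp_converges) auto
  also have "c powr (- (c * lam)) * exp (- lam) * exp (c * lam) = exp (- (lam * (c * ln c - c + 1)))"
    using \<open>0 < c\<close> by (simp add: powr_def exp_add[symmetric] algebra_simps)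
  finally show ?thesis by (simp add: emeasure_eq_measure)
qed

text \<open>Along integer radii the deviation probabilities are summable, and Borel-Cantelli applies
  for each relative error \<open>c\<close>.\<close>

lemma poisson_ball_count:
  fixes \<eta> :: "'w \<Rightarrow> 'a::euclidean_space set"
  assumes ppp: "poisson_point_process M \<nu> \<eta>" and "0 < \<nu>"
  shows "AE \<omega> in M. (\<lambda>n. real (card (\<eta> \<omega> \<inter> cball 0 (real n))) / real n ^ DIM('a))
    \<longlonglongrightarrow> \<nu> * unit_ball_vol (real DIM('a))"
proof -
  interpret prob_space M using ppp by (simp add: poisson_point_process_def)
  define \<kappa> where "\<kappa> = \<nu> * unit_ball_vol (real DIM('a))"
  have "0 < \<kappa>" using \<open>0 < \<nu>\<close> by (simp add: \<kappa>_def)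
  define N where "N n \<omega> = card (\<eta> \<omega> \<inter> cball 0 (real n))" for n \<omega>
  define lam where "lam n = \<kappa> * real n ^ DIM('a)" for n
  have N_meas[measurable]: "N n \<in> M \<rightarrow>\<^sub>M count_space UNIV" for n
    using ppp unfolding poisson_point_process_def N_def by auto
  have N_poisson: "measure M {\<omega> \<in> space M. N n \<omega> = k} = lam n ^ k / fact k * exp (- lam n)" for n k
  proof -
    have "\<nu> * measure lborel (cball (0::'a) (real n)) = lam n"
      by (simp add: content_cball lam_def \<kappa>_def)
    then show ?thesis
      using ppp unfolding poisson_point_process_def N_def by auto
  qed
  have dev: "AE \<omega> in M. \<forall>\<^sub>F n in sequentially. \<not> (c powr (c * lam n) \<le> c powr real (N n \<omega>))"
    if "0 < c" "c \<noteq> 1" for c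
  proof -
    let ?E = "\<lambda>n. {\<omega> \<in> space M. c powr (c * lam n) \<le> c powr real (N n \<omega>)}"
    define h where "h = c * ln c - c + 1"
    have "0 < h"
      using ln_less_self_minus_one[of "1 / c"] that by (simp add: h_def ln_div field_simps)
    have bnd: "measure M (?E n) \<le> exp (- (\<kappa> * h)) ^ n" for n
    proof -
      have "measure M (?E n) \<le> exp (- (lam n * h))"
        unfolding h_def using \<open>0 < \<kappa>\<close> that
        by (intro poisson_chernoff N_meas N_poisson prob_space_axioms) (auto simp: lam_def)
      \<comment> \<open>As the dimension is at least 1, the volume exponent may be weakened to a
        linear one, which gives a geometric series.\<close>
      also have "real n \<le> real n ^ DIM('a)"
        by (cases n) (auto simp: self_le_power)
      then have "exp (- (lam n * h)) \<le> exp (- (\<kappa> * h * real n))"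
        using \<open>0 < \<kappa>\<close> \<open>0 < h\<close> by (simp add: lam_def)
      also have "\<dots> = exp (- (\<kappa> * h)) ^ n"
        by (simp add: exp_of_nat_mult[symmetric] ac_simps)
      finally show ?thesis .
    qed
    have "summable (\<lambda>n. exp (- (\<kappa> * h)) ^ n)"
      using \<open>0 < \<kappa>\<close> \<open>0 < h\<close> by (intro summable_geometric) simp
    then have "summable (\<lambda>n. measure M (?E n))"
      by (rule summable_comparison_test'[where N=0]) (use bnd in auto)
    moreover have "?E n \<in> sets M" for n by measurable
    ultimately have "AE \<omega> in M. \<forall>\<^sub>F n in sequentially. \<omega> \<in> space M - ?E n"
      by (intro borel_cantelli_AE1) (auto simp: less_top[symmetric])
    then show ?thesis
      by eventually_elim (auto elim: eventually_mono)
  qed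
  \<comment> \<open>Restricting \<open>c\<close> to the rationals leaves countably many null sets;
    density recovers every margin \<open>b\<close> below.\<close>
  have "AE \<omega> in M. \<forall>c\<in>\<rat>. 0 < c \<longrightarrow> c \<noteq> (1::real) \<longrightarrow>
      (\<forall>\<^sub>F n in sequentially. \<not> (c powr (c * lam n) \<le> c powr real (N n \<omega>)))"
    using dev by (subst AE_ball_countable) (auto simp: countable_rat intro: AE_I2)
  then show ?thesis
  proof eventually_elim
    case (elim \<omega>)
    have "(\<lambda>n. real (N n \<omega>) / lam n) \<longlonglongrightarrow> 1"
    proof (rule order_tendstoI)
      fix b :: real assume "1 < b"
      then obtain c where c: "c \<in> \<rat>" "1 < c" "c < b" using Rats_dense_in_real by blast
      with elim have "\<forall>\<^sub>F n in sequentially. \<not> (c powr (c * lam n) \<le> c powr real (N n \<omega>))" by auto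
      then show "\<forall>\<^sub>F n in sequentially. real (N n \<omega>) / lam n < b"
        using eventually_gt_at_top[of 0]
      proof eventually_elim
        case (elim n)
        then have "0 < lam n" using \<open>0 < \<kappa>\<close> by (simp add: lam_def)
        moreover have "real (N n \<omega>) < c * lam n" using elim c by (simp add: not_le)
        ultimately have "real (N n \<omega>) / lam n < c" by (simp add: field_simps)
        then show ?case using c by simp
      qed
    next
      fix b :: real assume "b < 1"
      then obtain c where c: "c \<in> \<rat>" "max 0 b < c" "c < 1" using Rats_dense_in_real[of "max 0 b" 1] by auto
      with elim have "\<forall>\<^sub>F n in sequentially. \<not> (c powr (c * lam n) \<le> c powr real (N n \<omega>))" by auto
      then show "\<forall>\<^sub>F n in sequentially. b < real (N n \<omega>) / lam n"
        using eventually_gt_at_top[of 0]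
      proof eventually_elim
        case (elim n)
        then have "0 < lam n" using \<open>0 < \<kappa>\<close> by (simp add: lam_def)
        moreover have "c * lam n < real (N n \<omega>)"
        proof (rule ccontr)
          assume "\<not> c * lam n < real (N n \<omega>)"
          then have "c powr (c * lam n) \<le> c powr real (N n \<omega>)" using c by (intro powr_mono') auto
          then show False using elim by simp
        qed
        ultimately have "c < real (N n \<omega>) / lam n" by (simp add: field_simps)
        then show ?case using c by simp
      qed
    qed
    then have "(\<lambda>n. \<kappa> * (real (N n \<omega>) / lam n)) \<longlonglongrightarrow> \<kappa> * 1"
      by (intro tendsto_intros)
    moreover have "\<kappa> * (real (N n \<omega>) / lam n) = real (card (\<eta> \<omega> \<inter> cball 0 (real n))) / real n ^ DIM('a)" for n
      using \<open>0 < \<kappa>\<close> by (simp add: lam_def N_def)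
    ultimately show ?case by (simp add: \<kappa>_def[symmetric])
  qed
qed

text \<open>Leaving out the centre makes the count vanish at small radii, so that it can be bounded
  by a multiple of \<open>r ^ d\<close> down to \<open>r = 0\<close>.\<close>

definition ball_count :: "'a::metric_space set \<Rightarrow> 'a \<Rightarrow> real \<Rightarrow> real" where
  "ball_count V x r = real (card {y \<in> V - {x}. dist x y \<le> r})"

lemma finite_ball_count:
  "locally_finite_set V \<Longrightarrow> finite {y \<in> V - {x}. dist x y \<le> r}"
  unfolding locally_finite_set_def
  by (rule finite_subset[of _ "V \<inter> cball x r"]) auto

lemma locally_finite_exhaustion:
  assumes "locally_finite_set V"
  obtains F :: "nat \<Rightarrow> 'a::metric_space set"
  where "\<And>k. finite (F k)" and "incseq F" and "(\<Union>k. F k) = V - {x}"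
proof
  let ?F = "\<lambda>k::nat. {y \<in> V - {x}. dist x y \<le> real k}"
  show "finite (?F k)" for k by (rule finite_ball_count[OF assms])
  show "incseq ?F" by (auto simp: incseq_def)
  have "\<exists>k. dist x y \<le> real k" for y by (rule real_arch_simple)
  then show "(\<Union>k. ?F k) = V - {x}" by auto
qed

lemma ball_count_mono:
  assumes "locally_finite_set V" "r \<le> r'"
  shows "ball_count V x r \<le> ball_count V x r'"
  unfolding ball_count_def using assms(2)
  by (intro of_nat_mono card_mono finite_ball_count[OF assms(1)]) auto

text \<open>A ball at \<open>x\<close> lies between balls at the origin with integer radii near
  \<open>r - norm x\<close> and \<open>r + norm x\<close>, whose ratios to \<open>r\<close> tend to
  1. Hence one statement about the origin settles all centres and all real radii.\<close>

lemma ball_count_asymptotics: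
  fixes V :: "'a::real_normed_vector set"
  assumes lf: "locally_finite_set V" and "0 < d"
    and lim: "(\<lambda>n. real (card (V \<inter> cball 0 (real n))) / real n ^ d) \<longlonglongrightarrow> \<kappa>"
  shows "((\<lambda>r. ball_count V x r / r ^ d) \<longlongrightarrow> \<kappa>) at_top"
proof -
  have fin: "finite (V \<inter> cball 0 r)" for r
    using lf by (simp add: locally_finite_set_def)
  define N where "N n = real (card (V \<inter> cball 0 (real n)))" for n
  define lo where "lo r = nat \<lfloor>r - norm x\<rfloor>" for r
  define hi where "hi r = nat \<lceil>r + norm x\<rceil>" for r
  have lo_top: "filterlim lo sequentially at_top" and hi_top: "filterlim hi sequentially at_top"
    unfolding lo_def hi_def by real_asymp+
  have lo_r: "((\<lambda>r. real (lo r) / r) \<longlongrightarrow> 1) at_top" and hi_r: "((\<lambda>r. real (hi r) / r) \<longlongrightarrow> 1) at_top"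
    unfolding lo_def hi_def by real_asymp+
  have N_lim: "((\<lambda>r. N (g r) / r ^ d) \<longlongrightarrow> \<kappa>) at_top"
    if g: "filterlim g sequentially at_top" and g_r: "((\<lambda>r. real (g r) / r) \<longlongrightarrow> 1) at_top" for g
  proof -
    have "((\<lambda>r. N (g r) / real (g r) ^ d * (real (g r) / r) ^ d) \<longlongrightarrow> \<kappa> * 1 ^ d) at_top"
      by (intro tendsto_intros g_r filterlim_compose[OF lim[folded N_def] g])
    moreover have "\<forall>\<^sub>F r in at_top. N (g r) / real (g r) ^ d * (real (g r) / r) ^ d = N (g r) / r ^ d"
      using filterlim_at_top[THEN iffD1, OF g, rule_format, of 1] by eventually_elim (simp add: power_divide)
    ultimately show ?thesis by (simp add: tendsto_cong)
  qed
  have inv_0: "((\<lambda>r::real. 1 / r ^ d) \<longlongrightarrow> 0) at_top"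
    using \<open>0 < d\<close> by real_asymp
  show ?thesis
  proof (rule tendsto_sandwich)
    \<comment> \<open>The subtracted 1 pays for \<open>x\<close> itself, which the ball at the
      origin may count.\<close>
    show "((\<lambda>r. N (lo r) / r ^ d - 1 / r ^ d) \<longlongrightarrow> \<kappa>) at_top"
      using tendsto_diff[OF N_lim[OF lo_top lo_r] inv_0] by simp
    show "((\<lambda>r. N (hi r) / r ^ d) \<longlongrightarrow> \<kappa>) at_top"
      by (rule N_lim[OF hi_top hi_r])
    show "\<forall>\<^sub>F r in at_top. N (lo r) / r ^ d - 1 / r ^ d \<le> ball_count V x r / r ^ d"
      using eventually_ge_at_top[of "norm x + 1"]
    proof eventually_elim
      case (elim r)
      then have "0 < r" using norm_ge_zero[of x] by linarith
      have "V \<inter> cball 0 (real (lo r)) \<subseteq> insert x {y \<in> V - {x}. dist x y \<le> r}"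
      proof
        fix y assume y: "y \<in> V \<inter> cball 0 (real (lo r))"
        have "real (lo r) \<le> r - norm x" using elim by (simp add: lo_def)
        moreover have "dist x y \<le> norm x + norm y" by (simp add: dist_norm norm_triangle_ineq4)
        ultimately show "y \<in> insert x {y \<in> V - {x}. dist x y \<le> r}" using y by auto
      qed
      then have "card (V \<inter> cball 0 (real (lo r))) \<le> card (insert x {y \<in> V - {x}. dist x y \<le> r})"
        using finite_ball_count[OF lf] by (intro card_mono) auto
      then have "N (lo r) - 1 \<le> ball_count V x r"
        using finite_ball_count[OF lf] by (simp add: N_def ball_count_def)
      then show ?case using \<open>0 < r\<close> by (simp add: diff_divide_distrib[symmetric] divide_right_mono)
    qed
    show "\<forall>\<^sub>F r in at_top. ball_count V x r / r ^ d \<le> N (hi r) / r ^ d"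
      using eventually_ge_at_top[of 0]
    proof eventually_elim
      case (elim r)
      have "{y \<in> V - {x}. dist x y \<le> r} \<subseteq> V \<inter> cball 0 (real (hi r))"
      proof
        fix y assume y: "y \<in> {y \<in> V - {x}. dist x y \<le> r}"
        have "r + norm x \<le> real (hi r)" unfolding hi_def by (rule real_nat_ceiling_ge)
        moreover have "norm y \<le> norm x + dist x y"
          using norm_triangle_ineq4[of x "x - y"] by (simp add: dist_norm)
        ultimately show "y \<in> V \<inter> cball 0 (real (hi r))" using y by auto
      qed
      then have "ball_count V x r \<le> N (hi r)"
        unfolding ball_count_def N_def by (intro of_nat_mono card_mono fin)
      then show ?case using elim by (simp add: divide_right_mono)
    qed
  qed
qed

text \<open>The bound must hold for all radii, as it later dominates counts at random, possibly
  tiny, radii. Large radii follow from the limit, small ones from the isolation of \<open>x\<close>,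
  and those between from monotonicity.\<close>

lemma ball_count_bound:
  assumes lf: "locally_finite_set V" and lim: "((\<lambda>r. ball_count V x r / r ^ d) \<longlongrightarrow> \<kappa>) at_top"
  obtains K where "0 < K" and "\<And>r. 0 < r \<Longrightarrow> ball_count V x r \<le> K * r ^ d"
proof -
  have "\<forall>\<^sub>F r in at_top. ball_count V x r / r ^ d < \<bar>\<kappa>\<bar> + 1"
    by (rule order_tendstoD[OF lim]) simp
  then obtain R where R: "\<And>r. R \<le> r \<Longrightarrow> ball_count V x r / r ^ d < \<bar>\<kappa>\<bar> + 1"
    by (auto simp: eventually_at_top_linorder)
  \<comment> \<open>Including 1 keeps the minimum defined when \<open>x\<close> has no other vertex
    within distance 1, and keeps it below the distance of all vertices farther away.\<close>
  define A where "A = insert 1 (dist x ` {y \<in> V - {x}. dist x y \<le> 1})"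
  have A: "finite A" "A \<noteq> {}" unfolding A_def using finite_ball_count[OF lf] by auto
  define r0 where "r0 = Min A"
  have "0 < r0" unfolding r0_def using A by (subst Min_gr_iff) (auto simp: A_def)
  have zero: "ball_count V x r = 0" if "r < r0" for r
  proof -
    have "r0 \<le> dist x y" if "y \<in> V - {x}" "dist x y \<le> 1" for y
      unfolding r0_def using that A(1) by (intro Min_le) (auto simp: A_def)
    moreover have "r0 \<le> 1" unfolding r0_def using A(1) by (intro Min_le) (auto simp: A_def)
    ultimately have "{y \<in> V - {x}. dist x y \<le> r} = {}" using that by force
    then show ?thesis by (simp only: ball_count_def card.empty of_nat_0)
  qed
  define K where "K = \<bar>\<kappa>\<bar> + 1 + ball_count V x R / r0 ^ d"
  have nonneg: "0 \<le> ball_count V x R / r0 ^ d"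
    using \<open>0 < r0\<close> by (simp add: ball_count_def)
  show ?thesis
  proof
    show "0 < K" using nonneg by (simp add: K_def)
    fix r :: real assume "0 < r"
    consider "r < r0" | "r0 \<le> r" "r \<le> R" | "R \<le> r" by linarith
    then show "ball_count V x r \<le> K * r ^ d"
    proof cases
      case 1
      then show ?thesis using zero \<open>0 < K\<close> \<open>0 < r\<close> by simp
    next
      case 2
      have "ball_count V x r \<le> ball_count V x R" by (rule ball_count_mono[OF lf 2(2)])
      also have "\<dots> = ball_count V x R / r0 ^ d * r0 ^ d" using \<open>0 < r0\<close> by simp
      also have "\<dots> \<le> K * r ^ d"
        using nonneg 2 \<open>0 < r0\<close> by (intro mult_mono power_mono) (auto simp: K_def)
      finally show ?thesis .
    next
      case 3
      then have "ball_count V x r \<le> (\<bar>\<kappa>\<bar> + 1) * r ^ d"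
        using R[OF 3] \<open>0 < r\<close> by (simp add: field_simps)
      also have "\<dots> \<le> K * r ^ d" using nonneg \<open>0 < r\<close> by (intro mult_right_mono) (auto simp: K_def)
      finally show ?thesis .
    qed
  qed
qed

section \<open>The conditional mean degree\<close>

text \<open>Dominated convergence: the integrand divided by \<open>a powr \<beta>\<close> tends to
  \<open>\<kappa> * Z p powr \<beta>\<close>, and the global bound dominates it even where
  \<open>a * Z p\<close> is still small.\<close>

lemma scaled_integral_asymptotics:
  fixes n :: "real \<Rightarrow> real" and Z :: "'s \<Rightarrow> real"
  assumes [measurable]: "n \<in> borel_measurable borel" "Z \<in> borel_measurable S"
    and Z_pos: "AE p in S. 0 < Z p" and int: "integrable S (\<lambda>p. Z p powr \<beta>)"
    and lim: "((\<lambda>z. n z / z powr \<beta>) \<longlongrightarrow> \<kappa>) at_top"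
    and bnd: "\<And>z. 0 < z \<Longrightarrow> \<bar>n z\<bar> \<le> K * z powr \<beta>"
  shows "((\<lambda>a. (\<integral>p. n (a * Z p) \<partial>S) / a powr \<beta>) \<longlongrightarrow> \<kappa> * (\<integral>p. Z p powr \<beta> \<partial>S)) at_top"
proof -
  have "((\<lambda>a. \<integral>p. n (a * Z p) / a powr \<beta> \<partial>S) \<longlongrightarrow> (\<integral>p. \<kappa> * Z p powr \<beta> \<partial>S)) at_top"
  proof (rule integral_dominated_convergence_at_top[where w="\<lambda>p. K * Z p powr \<beta>"])
    show "AE p in S. ((\<lambda>a. n (a * Z p) / a powr \<beta>) \<longlongrightarrow> \<kappa> * Z p powr \<beta>) at_top"
      using Z_pos
    proof eventually_elim
      case (elim p)
      have top: "filterlim (\<lambda>a. a * Z p) at_top at_top"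
        by (rule filterlim_at_top_mult_tendsto_pos[OF tendsto_const elim filterlim_ident])
      have "((\<lambda>a. n (a * Z p) / (a * Z p) powr \<beta> * Z p powr \<beta>) \<longlongrightarrow> \<kappa> * Z p powr \<beta>) at_top"
        by (intro tendsto_intros filterlim_compose[OF lim top])
      moreover have "\<forall>\<^sub>F a in at_top. n (a * Z p) / (a * Z p) powr \<beta> * Z p powr \<beta> = n (a * Z p) / a powr \<beta>"
        using eventually_gt_at_top[of 0] by eventually_elim (use elim in \<open>simp add: powr_mult\<close>)
      ultimately show ?case by (rule Lim_transform_eventually)
    qed
    show "\<forall>\<^sub>F a in at_top. AE p in S. norm (n (a * Z p) / a powr \<beta>) \<le> K * Z p powr \<beta>"
      using eventually_gt_at_top[of 0]
    proof eventually_elim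
      case (elim a)
      show ?case using Z_pos
      proof eventually_elim
        case Z: (elim p)
        have "norm (n (a * Z p) / a powr \<beta>) = \<bar>n (a * Z p)\<bar> / a powr \<beta>" by simp
        also have "\<dots> \<le> K * (a * Z p) powr \<beta> / a powr \<beta>"
          using elim Z by (intro divide_right_mono bnd) auto
        also have "\<dots> = K * Z p powr \<beta>" using elim Z by (simp add: powr_mult)
        finally show ?case .
      qed
    qed
  qed (use int in auto)
  then show ?thesis by simp
qed

abbreviation exp_law :: "real measure" where
  "exp_law \<equiv> density lborel (\<lambda>t. ennreal (exponential_density 1 t))"

lemma AE_exp_law_pos: "AE t in exp_law. 0 < t"
proof -
  have "AE t in lborel. t \<noteq> (0::real)" by (rule AE_lborel_singleton)
  then have "AE t in lborel. 0 < ennreal (exponential_density 1 t) \<longrightarrow> 0 < t"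
    by eventually_elim (auto simp: exponential_density_def split: if_splits)
  then show ?thesis by (simp add: AE_density)
qed

text \<open>Since \<open>1 - exp (- z) = P(T \<le> z)\<close> for a standard exponential variable \<open>T\<close>, averaging an
  edge probability over the weight \<open>v\<close> of the far endpoint gives
  \<open>P(norm (x - y) powr \<alpha> \<le> a * (v / T))\<close>, so the conditional mean degree of \<open>x\<close> is the expected
  number of vertices in a ball of random radius.\<close>

context
  fixes W :: "real measure"
  assumes W: "real_distribution W" and pos: "AE v in W. 0 < v"
begin

interpretation W: real_distribution W by (rule W)
interpretation E: prob_space exp_law by (rule prob_space_exponential_density) simp
interpretation S: pair_prob_space W exp_law ..

lemma AE_pair_pos: "AE p in W \<Otimes>\<^sub>M exp_law. 0 < fst p \<and> 0 < snd p"
proof (rule S.AE_pair_measure)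
  show "{p \<in> space (W \<Otimes>\<^sub>M exp_law). 0 < fst p \<and> 0 < snd p} \<in> sets (W \<Otimes>\<^sub>M exp_law)"
    by measurable
  show "AE v in W. AE t in exp_law. 0 < fst (v, t) \<and> 0 < snd (v, t)"
    using pos AE_exp_law_pos by auto
qed

lemma mean_edge_prob_eq:
  fixes x y :: "'a::real_normed_vector"
  assumes "x \<noteq> y" "0 < a"
  shows "mean_edge_prob W \<alpha> x y a =
    (\<integral>p. indicator {z. norm (x - y) powr \<alpha> \<le> z} (a * (fst p / snd p)) \<partial>(W \<Otimes>\<^sub>M exp_law))"
proof -
  define r where "r = norm (x - y) powr \<alpha>"
  have "0 < r" using assms by (simp add: r_def)
  have "ennreal (\<integral>p. indicator {z. r \<le> z} (a * (fst p / snd p)) \<partial>(W \<Otimes>\<^sub>M exp_law)) =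
      (\<integral>\<^sup>+p. ennreal (indicator {z. r \<le> z} (a * (fst p / snd p))) \<partial>(W \<Otimes>\<^sub>M exp_law))"
    by (rule nn_integral_eq_integral[symmetric]) (auto intro!: S.P.integrable_const_bound[where B=1] simp: indicator_def)
  also have "\<dots> = (\<integral>\<^sup>+v. \<integral>\<^sup>+t. ennreal (indicator {z. r \<le> z} (a * (v / t))) \<partial>exp_law \<partial>W)"
    by (subst E.nn_integral_fst[symmetric]) auto
  also have "\<dots> = (\<integral>\<^sup>+v. ennreal (clip (1 - exp (- (a * v / r)))) \<partial>W)"
  proof (rule nn_integral_cong_AE, use pos in eventually_elim)
    case (elim v)
    have "(\<integral>\<^sup>+t. ennreal (indicator {z. r \<le> z} (a * (v / t))) \<partial>exp_law) = (\<integral>\<^sup>+t. indicator {..a * v / r} t \<partial>exp_law)"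
      using AE_exp_law_pos
      by (intro nn_integral_cong_AE, eventually_elim) (use \<open>0 < r\<close> in \<open>auto simp: indicator_def field_simps\<close>)
    also have "\<dots> = emeasure exp_law {..a * v / r}" by simp
    also have "\<dots> = ennreal (erlang_CDF 0 1 (a * v / r))"
      by (rule emeasure_erlang_density) simp
    \<comment> \<open>For a nonnegative argument the truncation in \<open>clip\<close> is inactive
      and the exponential distribution function is on its nontrivial branch.\<close>
    also have "0 \<le> a * v / r" using elim \<open>0 < a\<close> \<open>0 < r\<close> by simp
    then have "erlang_CDF 0 1 (a * v / r) = clip (1 - exp (- (a * v / r)))"
      by (simp add: erlang_CDF_def clip_def)
    finally show ?case .
  qed
  also have "\<dots> = ennreal (mean_edge_prob W \<alpha> x y a)"
    unfolding mean_edge_prob_def[OF W] r_def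
    by (intro nn_integral_eq_integral integrable_clip[OF W]) auto
  finally show ?thesis
    by (subst (asm) ennreal_inj) (auto simp: r_def mean_edge_prob_nonneg[OF W])
qed

text \<open>By independence the moment of the ratio is the \<beta>-moment of the weight times the
  moment of order \<open>- \<beta>\<close> of an exponential variable, which is
  \<open>Gamma (1 - \<beta>)\<close> and finite for \<beta> < 1. With \<beta> = d / \<alpha> this is
  where \<alpha> > d is used.\<close>

lemma integrable_ratio_powr:
  assumes mom: "(\<integral>\<^sup>+v. ennreal (v powr \<beta>) * indicator {0<..} v \<partial>W) < \<infinity>" and "\<beta> < 1"
  shows "integrable (W \<Otimes>\<^sub>M exp_law) (\<lambda>p. (fst p / snd p) powr \<beta>)"
    and "0 < (\<integral>p. (fst p / snd p) powr \<beta> \<partial>(W \<Otimes>\<^sub>M exp_law))"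
proof -
  have "(\<integral>\<^sup>+p. ennreal ((fst p / snd p) powr \<beta>) \<partial>(W \<Otimes>\<^sub>M exp_law)) =
      (\<integral>\<^sup>+v. \<integral>\<^sup>+t. ennreal ((v / t) powr \<beta>) \<partial>exp_law \<partial>W)"
    by (subst E.nn_integral_fst[symmetric]) auto
  also have "\<dots> = (\<integral>\<^sup>+v. ennreal (v powr \<beta>) * indicator {0<..} v * (\<integral>\<^sup>+t. ennreal (t powr (- \<beta>)) \<partial>exp_law) \<partial>W)"
  proof (rule nn_integral_cong_AE, use pos in eventually_elim)
    case (elim v)
    have "(\<integral>\<^sup>+t. ennreal ((v / t) powr \<beta>) \<partial>exp_law) = (\<integral>\<^sup>+t. ennreal (v powr \<beta>) * ennreal (t powr (- \<beta>)) \<partial>exp_law)"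
      using AE_exp_law_pos
      by (intro nn_integral_cong_AE, eventually_elim)
        (use elim in \<open>simp add: powr_divide powr_minus_divide ennreal_mult[symmetric]\<close>)
    then show ?case using elim by (simp add: nn_integral_cmult)
  qed
  also have "\<dots> = (\<integral>\<^sup>+v. ennreal (v powr \<beta>) * indicator {0<..} v \<partial>W) * (\<integral>\<^sup>+t. ennreal (t powr (- \<beta>)) \<partial>exp_law)"
    by (rule nn_integral_multc) measurable
  also have "(\<integral>\<^sup>+t. ennreal (t powr (- \<beta>)) \<partial>exp_law) =
      (\<integral>\<^sup>+t. ennreal (indicator {0..} t * t powr ((1 - \<beta>) - 1) / exp t) \<partial>lborel)"
    by (subst nn_integral_density)
      (auto intro!: nn_integral_cong simp: exponential_density_def ennreal_mult[symmetric] exp_minus indicator_def field_simps)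
  also have "\<dots> = ennreal (Gamma (1 - \<beta>))"
    using \<open>\<beta> < 1\<close> by (intro Gamma_conv_nn_integral_real[symmetric]) simp
  also have "(\<integral>\<^sup>+v. ennreal (v powr \<beta>) * indicator {0<..} v \<partial>W) * ennreal (Gamma (1 - \<beta>)) < \<infinity>"
    using mom by (simp add: ennreal_mult_less_top)
  finally show int: "integrable (W \<Otimes>\<^sub>M exp_law) (\<lambda>p. (fst p / snd p) powr \<beta>)"
    by (intro integrableI_nonneg) auto
  have "(\<integral>p. (fst p / snd p) powr \<beta> \<partial>(W \<Otimes>\<^sub>M exp_law)) \<noteq> 0"
  proof
    assume "(\<integral>p. (fst p / snd p) powr \<beta> \<partial>(W \<Otimes>\<^sub>M exp_law)) = 0"
    then have "AE p in W \<Otimes>\<^sub>M exp_law. (fst p / snd p) powr \<beta> = 0"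
      using int by (subst (asm) integral_nonneg_eq_0_iff_AE) auto
    with AE_pair_pos have "AE p in W \<Otimes>\<^sub>M exp_law. False"
      by eventually_elim auto
    then show False by simp
  qed
  then show "0 < (\<integral>p. (fst p / snd p) powr \<beta> \<partial>(W \<Otimes>\<^sub>M exp_law))"
    by (simp add: order_less_le)
qed

lemma mean_degree_asymptotics:
  fixes V :: "'a::real_normed_vector set" and F :: "nat \<Rightarrow> 'a set"
  assumes lf: "locally_finite_set V" and "0 < \<alpha>" "real d < \<alpha>" "0 < \<kappa>"
    and count: "((\<lambda>r. ball_count V x r / r ^ d) \<longlongrightarrow> \<kappa>) at_top"
    and mom: "(\<integral>\<^sup>+v. ennreal (v powr (real d / \<alpha>)) * indicator {0<..} v \<partial>W) < \<infinity>"
    and F: "\<And>k. finite (F k)" "incseq F" "(\<Union>k. F k) = V - {x}"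
  obtains m C where "0 < C" and "((\<lambda>a. m a / a powr (real d / \<alpha>)) \<longlongrightarrow> C) at_top"
    and "\<And>a. 0 < a \<Longrightarrow> (\<lambda>k. \<Sum>y\<in>F k. mean_edge_prob W \<alpha> x y a) \<longlonglongrightarrow> m a"
proof -
  define \<beta> where "\<beta> = real d / \<alpha>"
  \<comment> \<open>The number of vertices \<open>y\<close> with
    \<open>norm (x - y) powr \<alpha> \<le> z\<close>, of order \<open>z powr \<beta>\<close>. The
    value 0 off the positive axis keeps it monotone, hence Borel.\<close>
  define n where "n z = (if 0 < z then ball_count V x (z powr (1 / \<alpha>)) else 0)" for z
  define Z where "Z p = fst p / snd p" for p :: "real \<times> real"
  have [measurable]: "Z \<in> borel_measurable (W \<Otimes>\<^sub>M exp_law)" unfolding Z_def by measurable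
  have Z_pos: "AE p in W \<Otimes>\<^sub>M exp_law. 0 < Z p"
    using AE_pair_pos by eventually_elim (simp add: Z_def)
  have "\<beta> < 1" using assms(2,3) by (simp add: \<beta>_def)
  note ratio = integrable_ratio_powr[OF mom[folded \<beta>_def] this, folded Z_def]
  obtain K where K: "0 < K" "\<And>r. 0 < r \<Longrightarrow> ball_count V x r \<le> K * r ^ d"
    by (rule ball_count_bound[OF lf count]) (rule that)
  have pow: "(z powr (1 / \<alpha>)) ^ d = z powr \<beta>" if "0 < z" for z
    using that by (simp add: powr_realpow[symmetric] powr_powr \<beta>_def)
  have n_bnd: "\<bar>n z\<bar> \<le> K * z powr \<beta>" if "0 < z" for z
    using K(2)[of "z powr (1 / \<alpha>)"] that by (simp add: n_def pow) (simp add: ball_count_def)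
  have "mono n"
  proof (rule monoI)
    fix z z' :: real assume "z \<le> z'"
    moreover have "0 \<le> ball_count V x r" for r by (simp add: ball_count_def)
    ultimately show "n z \<le> n z'"
      using \<open>0 < \<alpha>\<close> unfolding n_def by (auto intro!: ball_count_mono[OF lf] powr_mono2)
  qed
  then have n_meas[measurable]: "n \<in> borel_measurable borel" by (rule borel_measurable_mono)
  have root_top: "filterlim (\<lambda>z. z powr (1 / \<alpha>)) at_top at_top"
    using \<open>0 < \<alpha>\<close> by real_asymp
  have "((\<lambda>z. ball_count V x (z powr (1 / \<alpha>)) / (z powr (1 / \<alpha>)) ^ d) \<longlongrightarrow> \<kappa>) at_top"
    by (rule filterlim_compose[OF count root_top])
  moreover have "\<forall>\<^sub>F z in at_top. ball_count V x (z powr (1 / \<alpha>)) / (z powr (1 / \<alpha>)) ^ d = n z / z powr \<beta>"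
    using eventually_gt_at_top[of 0] by eventually_elim (simp add: n_def pow)
  ultimately have n_lim: "((\<lambda>z. n z / z powr \<beta>) \<longlongrightarrow> \<kappa>) at_top"
    by (rule Lim_transform_eventually)
  define m where "m a = (\<integral>p. n (a * Z p) \<partial>(W \<Otimes>\<^sub>M exp_law))" for a
  show ?thesis
  proof (rule that[of "\<kappa> * (\<integral>p. Z p powr \<beta> \<partial>(W \<Otimes>\<^sub>M exp_law))" m])
    show "0 < \<kappa> * (\<integral>p. Z p powr \<beta> \<partial>(W \<Otimes>\<^sub>M exp_law))"
      using ratio(2) \<open>0 < \<kappa>\<close> by simp
    show "((\<lambda>a. m a / a powr (real d / \<alpha>)) \<longlongrightarrow> \<kappa> * (\<integral>p. Z p powr \<beta> \<partial>(W \<Otimes>\<^sub>M exp_law))) at_top"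
      unfolding m_def \<beta>_def[symmetric]
      by (rule scaled_integral_asymptotics[OF _ _ Z_pos ratio(1) n_lim n_bnd]) auto
  next
    fix a :: real assume "0 < a"
    \<comment> \<open>The same count restricted to \<open>F k\<close>. At each \<open>z > 0\<close>
      it eventually equals \<open>n z\<close>, because the finitely many vertices of the ball are
      eventually all in \<open>F k\<close>; its integral is the finite sum of averaged edge
      probabilities.\<close>
    define nk :: "nat \<Rightarrow> real \<Rightarrow> real"
      where "nk k z = (\<Sum>y\<in>F k. indicator {z. norm (x - y) powr \<alpha> \<le> z} z)" for k z
    have nk_meas[measurable]: "nk k \<in> borel_measurable borel" for k
      unfolding nk_def by measurable
    have count_eq: "norm (x - y) powr \<alpha> \<le> z \<longleftrightarrow> dist x y \<le> z powr (1 / \<alpha>)" if "0 < z" for y z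
    proof -
      have "dist x y \<le> z powr (1 / \<alpha>) \<longleftrightarrow> dist x y powr \<alpha> \<le> (z powr (1 / \<alpha>)) powr \<alpha>"
        using \<open>0 < \<alpha>\<close> by (meson linorder_not_less powr_ge_zero powr_less_mono2 powr_mono2 less_imp_le zero_le_dist)
      then show ?thesis using that \<open>0 < \<alpha>\<close> by (simp add: powr_powr dist_norm)
    qed
    have nk_card: "nk k z = real (card {y \<in> F k. dist x y \<le> z powr (1 / \<alpha>)})" if "0 < z" for k z
      unfolding nk_def using count_eq[OF that] F(1)
      by (simp add: indicator_def sum.If_cases Int_def)
    have nk_le: "nk k z \<le> n z" if "0 < z" for k z
    proof -
      have "{y \<in> F k. dist x y \<le> z powr (1 / \<alpha>)} \<subseteq> {y \<in> V - {x}. dist x y \<le> z powr (1 / \<alpha>)}"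
        using F(3) by blast
      from card_mono[OF finite_ball_count[OF lf] this] show ?thesis
        using that by (simp add: nk_card n_def ball_count_def)
    qed
    have FV: "F k \<subseteq> V - {x}" for k using F(3) by auto
    have nk_lim: "(\<lambda>k. nk k z) \<longlonglongrightarrow> n z" if "0 < z" for z
    proof -
      let ?B = "{y \<in> V - {x}. dist x y \<le> z powr (1 / \<alpha>)}"
      have "\<forall>\<^sub>F k in sequentially. y \<in> F k" if y: "y \<in> ?B" for y
      proof -
        have "y \<in> (\<Union>k. F k)" using y F(3) by simp
        then obtain k0 where k0: "y \<in> F k0" by (rule UN_E)
        have "y \<in> F k" if "k0 \<le> k" for k
          using k0 incseqD[OF F(2) that] by (rule rev_subsetD)
        then show ?thesis by (auto simp: eventually_sequentially)
      qed
      then have "\<forall>\<^sub>F k in sequentially. \<forall>y\<in>?B. y \<in> F k"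
        by (rule eventually_ball_finite[OF finite_ball_count[OF lf] ballI])
      then have "\<forall>\<^sub>F k in sequentially. nk k z = n z"
      proof eventually_elim
        case (elim k)
        then have "{y \<in> F k. dist x y \<le> z powr (1 / \<alpha>)} = ?B" using FV[of k] by auto
        then show ?case using that by (simp only: nk_card n_def ball_count_def if_True)
      qed
      then show ?thesis by (rule tendsto_eventually)
    qed
    have "(\<lambda>k. \<integral>p. nk k (a * Z p) \<partial>(W \<Otimes>\<^sub>M exp_law)) \<longlonglongrightarrow> m a"
      unfolding m_def
    proof (rule integral_dominated_convergence[where w="\<lambda>p. K * a powr \<beta> * Z p powr \<beta>"])
      show "integrable (W \<Otimes>\<^sub>M exp_law) (\<lambda>p. K * a powr \<beta> * Z p powr \<beta>)"
        using ratio(1) by simp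
      show "AE p in W \<Otimes>\<^sub>M exp_law. (\<lambda>k. nk k (a * Z p)) \<longlonglongrightarrow> n (a * Z p)"
        using Z_pos by eventually_elim (use \<open>0 < a\<close> in \<open>auto intro: nk_lim\<close>)
      show "AE p in W \<Otimes>\<^sub>M exp_law. norm (nk k (a * Z p)) \<le> K * a powr \<beta> * Z p powr \<beta>" for k
        using Z_pos
      proof eventually_elim
        case (elim p)
        then have "0 < a * Z p" using \<open>0 < a\<close> by simp
        have "norm (nk k (a * Z p)) = nk k (a * Z p)" by (simp add: nk_card[OF \<open>0 < a * Z p\<close>])
        also have "\<dots> \<le> K * (a * Z p) powr \<beta>"
          using nk_le[OF \<open>0 < a * Z p\<close>, of k] n_bnd[OF \<open>0 < a * Z p\<close>] by linarith
        also have "\<dots> = K * a powr \<beta> * Z p powr \<beta>"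
          using elim \<open>0 < a\<close> by (simp add: powr_mult)
        finally show ?case .
      qed
    qed measurable
    moreover have "(\<integral>p. nk k (a * Z p) \<partial>(W \<Otimes>\<^sub>M exp_law)) = (\<Sum>y\<in>F k. mean_edge_prob W \<alpha> x y a)" for k
    proof -
      have "x \<noteq> y" if "y \<in> F k" for y using that F(3) by auto
      then show ?thesis
        unfolding nk_def Z_def
        by (subst Bochner_Integration.integral_sum)
          (auto intro!: S.P.integrable_const_bound[where B=1] sum.cong simp: mean_edge_prob_eq \<open>0 < a\<close>)
    qed
    ultimately show "(\<lambda>k. \<Sum>y\<in>F k. mean_edge_prob W \<alpha> x y a) \<longlonglongrightarrow> m a" by simp
  qed
qed

end

section \<open>The degree tail\<close>

lemma degree_tail_regularly_varying:
  fixes V :: "'a::real_normed_vector set"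
  assumes W: "real_distribution W" and pos: "AE v in W. 0 < v"
    and G: "regularly_varying (- \<rho>) (\<lambda>a. measure W {a<..})" and "0 < \<rho>"
    and "0 < \<alpha>" "0 < d" "real d < \<alpha>" "real d / \<alpha> < \<rho>" "0 < \<kappa>"
    and lf: "locally_finite_set V" and x: "x \<in> V"
    and count: "((\<lambda>r. ball_count V x r / r ^ d) \<longlongrightarrow> \<kappa>) at_top"
  defines "Q \<equiv> quenched_law W \<alpha> V"
  shows "regularly_varying (- (\<rho> / (real d / \<alpha>)))
    (\<lambda>s. measure Q {g \<in> space Q. vertex_degree V x g > ennreal s})"
proof -
  interpret W: real_distribution W by (rule W)
  have anti: "antimono (\<lambda>a. measure W {a<..})"
    by (intro antimonoI W.finite_measure_mono) auto
  \<comment> \<open>The power bound on the tail loses a little of the exponent \<rho>; the gap above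
    \<open>real d / \<alpha>\<close> leaves room for this and for the geometric series behind the
    moment.\<close>
  obtain \<sigma> where \<sigma>: "real d / \<alpha> < \<sigma>" "\<sigma> < \<rho>" using dense[OF \<open>real d / \<alpha> < \<rho>\<close>] by blast
  have \<beta>: "0 < real d / \<alpha>" using \<open>0 < \<alpha>\<close> \<open>0 < d\<close> by simp
  obtain K t0 where K: "t0 \<ge> 1" "\<And>t. t0 \<le> t \<Longrightarrow> measure W {t<..} \<le> K * t powr (- \<sigma>)"
    by (rule regularly_varying_upper[OF G anti, of \<sigma>]) (use \<sigma> \<beta> that in auto)
  have mom: "(\<integral>\<^sup>+v. ennreal (v powr (real d / \<alpha>)) * indicator {0<..} v \<partial>W) < \<infinity>"
    by (rule moment_finite[OF W.prob_space_axioms _ \<beta> \<sigma>(1) K]) auto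
  obtain F where F: "\<And>k. finite (F k)" "incseq F" "(\<Union>k. F k) = V - {x}"
    by (rule locally_finite_exhaustion[OF lf]) (rule that)
  obtain m C where "0 < C" and m: "((\<lambda>a. m a / a powr (real d / \<alpha>)) \<longlongrightarrow> C) at_top"
    and sum: "\<And>a. 0 < a \<Longrightarrow> (\<lambda>k. \<Sum>y\<in>F k. mean_edge_prob W \<alpha> x y a) \<longlonglongrightarrow> m a"
    by (rule mean_degree_asymptotics[OF W pos lf \<open>0 < \<alpha>\<close> \<open>real d < \<alpha>\<close> \<open>0 < \<kappa>\<close> count mom F]) (rule that)
  note bounds = degree_tail_bounds[OF W pos x F, where \<alpha>=\<alpha>, folded Q_def]
  show ?thesis
  proof (rule tail_asymptotics[OF G anti \<open>0 < \<rho>\<close> \<beta> \<open>0 < C\<close> m])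
    fix c a s :: real assume "1 < c" "0 < a" "0 < s"
    then show "measure Q {g \<in> space Q. vertex_degree V x g > ennreal s} \<le>
        measure W {a<..} + c powr (- s) * exp ((c - 1) * m a)"
      by (intro bounds(1) sum) auto
  next
    fix c a s :: real assume "0 < c" "c < 1" "0 < a" "0 < s"
    then show "measure W {a<..} * (1 - c powr (- s) * exp ((c - 1) * m a)) \<le>
        measure Q {g \<in> space Q. vertex_degree V x g > ennreal s}"
      by (intro bounds(2) sum) auto
  qed
qed

theorem theorem2p3:
  fixes M :: "'w measure" and \<eta> :: "'w \<Rightarrow> 'a::euclidean_space set"
    and W :: "real measure" and L :: "real \<Rightarrow> real" and \<nu> \<alpha> \<tau> \<gamma> :: real
  assumes "\<nu> > 0" and "\<alpha> > 0" and "\<tau> > 1"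
    and "poisson_point_process M \<nu> \<eta>"
    and "real_distribution W" and "AE w in W. w > 0"
    and "slowly_varying L"
    and "\<And>w. w > 0 \<Longrightarrow> 1 - cdf W w = w powr (- (\<tau> - 1)) * L w"
    and "\<alpha> > real DIM('a)"
    and "\<gamma> = \<alpha> * (\<tau> - 1) / real DIM('a)" and "\<gamma> > 1"
  shows "AE \<omega> in M. \<forall>x\<in>\<eta> \<omega>. \<exists>l. slowly_varying l \<and>
           (\<forall>s>0. measure (quenched_law W \<alpha> (\<eta> \<omega>))
                     {g \<in> space (quenched_law W \<alpha> (\<eta> \<omega>)). vertex_degree (\<eta> \<omega>) x g > ennreal s}
                   = s powr (- \<gamma>) * l s)"
proof -
  interpret W: real_distribution W by fact
  have "measure W {a<..} = 1 - cdf W a" for a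
    using W.prob_compl[of "{..a}"] by (simp add: cdf_def Compl_atMost[symmetric] Compl_eq_Diff_UNIV)
  then have G: "regularly_varying (- (\<tau> - 1)) (\<lambda>a. measure W {a<..})"
    using assms(7,8) by (intro slowly_varying_imp_regularly_varying[of L]) auto
  have \<gamma>: "(\<tau> - 1) / (real DIM('a) / \<alpha>) = \<gamma>"
    using assms(10) by (simp add: field_simps)
  \<comment> \<open>In terms of the exponents, \<gamma> > 1 says that d / \<alpha> lies below the
    tail index \<tau> - 1 of the weights.\<close>
  have "real DIM('a) / \<alpha> * 1 < real DIM('a) / \<alpha> * \<gamma>"
    using assms(2,11) by (intro mult_strict_left_mono) auto
  then have \<beta>: "real DIM('a) / \<alpha> < \<tau> - 1"
    using assms(2) by (simp add: \<gamma>[symmetric])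
  have "\<forall>\<omega>\<in>space M. locally_finite_set (\<eta> \<omega>)"
    using assms(4) by (simp add: poisson_point_process_def)
  then have "AE \<omega> in M. locally_finite_set (\<eta> \<omega>)" by (auto intro: AE_I2)
  \<comment> \<open>The two almost sure properties do not mention a vertex, so \<open>x\<close> may
    be fixed after the outcome.\<close>
  then show ?thesis using poisson_ball_count[OF assms(4,1)]
  proof eventually_elim
    case (elim \<omega>)
    show ?case
    proof
      fix x assume x: "x \<in> \<eta> \<omega>"
      let ?Q = "quenched_law W \<alpha> (\<eta> \<omega>)"
      define T where "T s = measure ?Q {g \<in> space ?Q. vertex_degree (\<eta> \<omega>) x g > ennreal s}" for s
      obtain F where F: "\<And>k. finite (F k)" "incseq F" "(\<Union>k. F k) = \<eta> \<omega> - {x}"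
        by (rule locally_finite_exhaustion[OF elim(1)]) (rule that)
      have "regularly_varying (- \<gamma>) T"
        unfolding T_def \<gamma>[symmetric] using assms(1,2,3,5,6,9) elim(1) \<beta> x
        by (intro degree_tail_regularly_varying[where \<kappa>="\<nu> * unit_ball_vol (real DIM('a))"] G
            ball_count_asymptotics elim(2)) auto
      moreover have "T t \<le> T s" if "0 \<le> s" "s \<le> t" for s t
        unfolding T_def using that by (rule degree_tail_antimono[OF assms(5) x F])
      ultimately have "slowly_varying (\<lambda>s. s powr \<gamma> * T s)"
        by (rule regularly_varying_imp_slowly_varying)
      moreover have "\<forall>s>0. T s = s powr (- \<gamma>) * (s powr \<gamma> * T s)"
        by (simp add: powr_minus)
      ultimately show "\<exists>l. slowly_varying l \<and> (\<forall>s>0. measure ?Q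
          {g \<in> space ?Q. vertex_degree (\<eta> \<omega>) x g > ennreal s} = s powr (- \<gamma>) * l s)"
        unfolding T_def by blast
    qed
  qed
qed

end
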